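(* If $G$ is an $r$-regular simple mixed graph, then the largest eigenvalue of $\mathcal{I}(G)$ is $\boldsymbol{\lambda}_1(G)=r$, and the multiplicity of $r$ as an eigenvalue of $\mathcal{I}(G)$ equals the number of mixed components of $G$.
   Context: A mixed graph $G$ has a finite nonempty vertex set $V_G=\{v_1,\dots,v_n\}$, a finite set $E_G$ of (undirected) edges, each joining an unordered pair of vertices $\{u,v\}$ (a loop if $u=v$), and a finite set $\vec E_G$ of arcs, each going from $u$ to $v$ for an ordered pair $(u,v)$ of vertices (a directed loop if $u=v$); multiple edges, loops, arcs and directed loops are allowed. $G$ is simple if it has no loops, no directed loops, at most one edge joining any two vertices, and at most one arc from $u$ to $v$ for each ordered pair $(u,v)$ (an edge and arcs in both directions may coexist on the same pair of vertices). The integrated adjacency matrix $\mathcal{I}(G)$ is the real symmetric $2n\times 2n$ matrix $\begin{bmatrix}A&D\\ D^T&A\end{bmatrix}$, where $A_{ij}$ ($i\neq j$) is the number of edges joining $v_i$ and $v_j$, $A_{ii}$ is twice the number of loops at $v_i$, and $D_{ij}$ is the number of arcs from $v_i$ to $v_j$. Its eigenvalues are arranged as $\boldsymbol{\lambda}_1(G)\ge\cdots\ge\boldsymbol{\lambda}_{2n}(G)$. $d(u)$ is the number of edges incident with $u$ (loops counted twice), $d^+(u)$ and $d^-(u)$ are the numbers of arcs starting and ending at $u$. $G$ is $r$-regular if $d^+(u)=d^-(u)$ and $d(u)+d^+(u)=r$ for all $u\in V_G$. A submixed graph of $G$ is given by subsets of the vertices, edges and arcs, with the restricted incidences. The undirected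 part $G_u$ is the graph with vertex set $V_G$ and edge set $E_G$ (no arcs). Components are connected components (for mixed graphs, ignoring directions of arcs). A walk in $G$ is a sequence $u_1,e_1,u_2,\dots,e_k,u_{k+1}$ where each $e_j$ is an edge joining $u_j,u_{j+1}$, or an arc from $u_j$ to $u_{j+1}$ (traversed forward), or an arc from $u_{j+1}$ to $u_j$ (traversed backward). It is closed if $u_1=u_{k+1}$. An alternating walk is a walk containing at least one arc in which, starting from the first arc, successive arcs alternate between forward and backward direction. Numbers of arcs in a walk are counted with repetition. A submixed graph $G'$ of $G$ with at least one arc is a special submixed graph of $G$ if: any two distinct vertices of $G'$ are joined by an alternating walk in $G'$; and if a component $H$ of $G'_u$ has at least one vertex at which some arc of $G'$ ends and at least one vertex at which some arc of $G'$ starts, then for each vertex $v$ of $H$ there is a closed alternating walk in $G'$ starting and ending at $v$ and containing an odd number of arcs. A submixed graph $G'$ of $G$ is a mixed component of $G$ if it is one of: Type I: a component of $G_u$ each of whose vertices has out-degree zero in $G$; Type II: a component of $G_u$ each of whose vertices has in-degree zero in $G$; Type III: a maximal special submixed graph of $G$. In counting mixed components, a component of $G$ with no arcs is counted twice (once as Type I and once as Type II). *)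

theory Defs
  imports "Jordan_Normal_Form.Char_Poly" "HOL-Library.Multiset"
begin

text \<open>
  An edge joining \<open>u\<close> and \<open>v\<close> has \<open>ends G e = {u, v}\<close>, so a loop at \<open>u\<close> has
  \<open>ends G e = {u}\<close>; an arc goes from its \<open>tail\<close> to its \<open>head\<close>. The incidence functions are total,
  but only their values on \<open>edges G\<close> and \<open>arcs G\<close> carry meaning.
\<close>

record ('v, 'e, 'a) mixed_graph =
  verts :: "'v set"
  edges :: "'e set"
  arcs :: "'a set"
  ends :: "'e \<Rightarrow> 'v set"
  tail :: "'a \<Rightarrow> 'v"
  head :: "'a \<Rightarrow> 'v"

definition is_mixed_graph :: "('v, 'e, 'a) mixed_graph \<Rightarrow> bool" where
  "is_mixed_graph G \<longleftrightarrow>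
     finite (verts G) \<and> verts G \<noteq> {} \<and> finite (edges G) \<and> finite (arcs G) \<and>
     (\<forall>e\<in>edges G. \<exists>u\<in>verts G. \<exists>v\<in>verts G. ends G e = {u, v}) \<and>
     (\<forall>a\<in>arcs G. tail G a \<in> verts G \<and> head G a \<in> verts G)"

definition simple :: "('v, 'e, 'a) mixed_graph \<Rightarrow> bool" where
  "simple G \<longleftrightarrow>
     (\<forall>e\<in>edges G. \<forall>u. ends G e \<noteq> {u}) \<and>
     (\<forall>a\<in>arcs G. tail G a \<noteq> head G a) \<and>
     (\<forall>u v. card {e \<in> edges G. ends G e = {u, v}} \<le> 1) \<and>
     (\<forall>u v. card {a \<in> arcs G. tail G a = u \<and> head G a = v} \<le> 1)"

definition edge_degree :: "('v, 'e, 'a) mixed_graph \<Rightarrow> 'v \<Rightarrow> nat" where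
  "edge_degree G u = card {e \<in> edges G. u \<in> ends G e} + card {e \<in> edges G. ends G e = {u}}"

definition out_degree :: "('v, 'e, 'a) mixed_graph \<Rightarrow> 'v \<Rightarrow> nat" where
  "out_degree G u = card {a \<in> arcs G. tail G a = u}"

definition in_degree :: "('v, 'e, 'a) mixed_graph \<Rightarrow> 'v \<Rightarrow> nat" where
  "in_degree G u = card {a \<in> arcs G. head G a = u}"

definition regular :: "nat \<Rightarrow> ('v, 'e, 'a) mixed_graph \<Rightarrow> bool" where
  "regular r G \<longleftrightarrow>
     (\<forall>u\<in>verts G. out_degree G u = in_degree G u \<and> edge_degree G u + out_degree G u = r)"

text \<open>The list \<open>vs\<close> is the enumeration \<open>v\<^sub>1, \<dots>, v\<^sub>n\<close> of the vertices (indexed from \<open>0\<close>).\<close>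

definition edge_block :: "('v, 'e, 'a) mixed_graph \<Rightarrow> 'v list \<Rightarrow> real mat" where
  "edge_block G vs = mat (length vs) (length vs) (\<lambda>(i, j).
     (if i = j then 2 else 1) * real (card {e \<in> edges G. ends G e = {vs ! i, vs ! j}}))"

definition arc_block :: "('v, 'e, 'a) mixed_graph \<Rightarrow> 'v list \<Rightarrow> real mat" where
  "arc_block G vs = mat (length vs) (length vs) (\<lambda>(i, j).
     real (card {a \<in> arcs G. tail G a = vs ! i \<and> head G a = vs ! j}))"

definition integrated_adjacency :: "('v, 'e, 'a) mixed_graph \<Rightarrow> 'v list \<Rightarrow> real mat" where
  "integrated_adjacency G vs =
     four_block_mat (edge_block G vs) (arc_block G vs)
                    (transpose_mat (arc_block G vs)) (edge_block G vs)"

text \<open>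
  The real roots of the characteristic polynomial, repeated according to multiplicity, in
  decreasing order. For a symmetric real \<open>m \<times> m\<close> matrix these are all \<open>m\<close> eigenvalues.
\<close>

definition eigenvalues_desc :: "real mat \<Rightarrow> real list" where
  "eigenvalues_desc M = rev (sorted_list_of_multiset (proots (char_poly M)))"

text \<open>\<open>lambda M k\<close> is the \<open>k\<close>-th largest eigenvalue, counted from \<open>k = 1\<close>.\<close>

definition lambda :: "real mat \<Rightarrow> nat \<Rightarrow> real" where
  "lambda M k = eigenvalues_desc M ! (k - 1)"

definition eigenvalue_multiplicity :: "real mat \<Rightarrow> real \<Rightarrow> nat" where
  "eigenvalue_multiplicity M x = order x (char_poly M)"

text \<open>
  The total incidence functions of a submixed graph are those of \<open>G\<close>, so that a submixed graph is
  determined by its vertices, edges and arcs; this matters when submixed graphs are counted.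
\<close>

definition submixed :: "('v, 'e, 'a) mixed_graph \<Rightarrow> ('v, 'e, 'a) mixed_graph \<Rightarrow> bool" where
  "submixed H G \<longleftrightarrow>
     is_mixed_graph H \<and> verts H \<subseteq> verts G \<and> edges H \<subseteq> edges G \<and> arcs H \<subseteq> arcs G \<and>
     ends H = ends G \<and> tail H = tail G \<and> head H = head G"

definition undirected_part :: "('v, 'e, 'a) mixed_graph \<Rightarrow> ('v, 'e, 'a) mixed_graph" where
  "undirected_part G = G\<lparr>arcs := {}\<rparr>"

datatype ('e, 'a) step = Edge 'e | is_forward: Forward 'a | is_backward: Backward 'a

fun traverses ::
    "('v, 'e, 'a) mixed_graph \<Rightarrow> 'v \<Rightarrow> ('e, 'a) step \<Rightarrow> 'v \<Rightarrow> bool" where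
  "traverses G u (Edge e) v \<longleftrightarrow> e \<in> edges G \<and> ends G e = {u, v}"
| "traverses G u (Forward a) v \<longleftrightarrow> a \<in> arcs G \<and> tail G a = u \<and> head G a = v"
| "traverses G u (Backward a) v \<longleftrightarrow> a \<in> arcs G \<and> head G a = u \<and> tail G a = v"

text \<open>
  \<open>walk G u ss v\<close>: the steps \<open>ss\<close> form a walk from \<open>u\<close> to \<open>v\<close>. The vertices in between are not
  recorded, as they are determined by \<open>u\<close> and \<open>ss\<close>.
\<close>

fun walk :: "('v, 'e, 'a) mixed_graph \<Rightarrow> 'v \<Rightarrow> ('e, 'a) step list \<Rightarrow> 'v \<Rightarrow> bool" where
  "walk G u [] v \<longleftrightarrow> u \<in> verts G \<and> u = v"
| "walk G u (s # ss) v \<longleftrightarrow> u \<in> verts G \<and> (\<exists>w. traverses G u s w \<and> walk G w ss v)"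

definition arc_steps :: "('e, 'a) step list \<Rightarrow> ('e, 'a) step list" where
  "arc_steps ss = filter (\<lambda>s. is_forward s \<or> is_backward s) ss"

definition alternating :: "('e, 'a) step list \<Rightarrow> bool" where
  "alternating ss \<longleftrightarrow>
     arc_steps ss \<noteq> [] \<and> successively (\<lambda>s t. is_forward s \<noteq> is_forward t) (arc_steps ss)"

definition alternating_walk ::
    "('v, 'e, 'a) mixed_graph \<Rightarrow> 'v \<Rightarrow> ('e, 'a) step list \<Rightarrow> 'v \<Rightarrow> bool" where
  "alternating_walk G u ss v \<longleftrightarrow> walk G u ss v \<and> alternating ss"

definition mixed_connected :: "('v, 'e, 'a) mixed_graph \<Rightarrow> bool" where
  "mixed_connected G \<longleftrightarrow> (\<forall>u\<in>verts G. \<forall>v\<in>verts G. \<exists>ss. walk G u ss v)"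

definition is_component :: "('v, 'e, 'a) mixed_graph \<Rightarrow> ('v, 'e, 'a) mixed_graph \<Rightarrow> bool" where
  "is_component H G \<longleftrightarrow>
     submixed H G \<and> mixed_connected H \<and>
     (\<forall>K. submixed K G \<and> mixed_connected K \<and> submixed H K \<longrightarrow> K = H)"

definition special :: "('v, 'e, 'a) mixed_graph \<Rightarrow> ('v, 'e, 'a) mixed_graph \<Rightarrow> bool" where
  "special G' G \<longleftrightarrow>
     submixed G' G \<and> arcs G' \<noteq> {} \<and>
     (\<forall>u\<in>verts G'. \<forall>v\<in>verts G'. u \<noteq> v \<longrightarrow> (\<exists>ss. alternating_walk G' u ss v)) \<and>
     (\<forall>H. is_component H (undirected_part G') \<and>
          (\<exists>a\<in>arcs G'. head G' a \<in> verts H) \<and> (\<exists>a\<in>arcs G'. tail G' a \<in> verts H) \<longrightarrow>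
          (\<forall>v\<in>verts H. \<exists>ss. alternating_walk G' v ss v \<and> odd (length (arc_steps ss))))"

definition type_I :: "('v, 'e, 'a) mixed_graph \<Rightarrow> ('v, 'e, 'a) mixed_graph \<Rightarrow> bool" where
  "type_I H G \<longleftrightarrow> is_component H (undirected_part G) \<and> (\<forall>v\<in>verts H. out_degree G v = 0)"

definition type_II :: "('v, 'e, 'a) mixed_graph \<Rightarrow> ('v, 'e, 'a) mixed_graph \<Rightarrow> bool" where
  "type_II H G \<longleftrightarrow> is_component H (undirected_part G) \<and> (\<forall>v\<in>verts H. in_degree G v = 0)"

definition type_III :: "('v, 'e, 'a) mixed_graph \<Rightarrow> ('v, 'e, 'a) mixed_graph \<Rightarrow> bool" where
  "type_III H G \<longleftrightarrow> special H G \<and> (\<forall>K. special K G \<and> submixed H K \<longrightarrow> K = H)"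

definition mixed_component :: "('v, 'e, 'a) mixed_graph \<Rightarrow> ('v, 'e, 'a) mixed_graph \<Rightarrow> bool" where
  "mixed_component H G \<longleftrightarrow> type_I H G \<or> type_II H G \<or> type_III H G"

text \<open>
  The second summand counts the components of \<open>G\<close> without arcs a second time: these are the
  submixed graphs that are mixed components both of type I and of type II.
\<close>

definition num_mixed_components :: "('v, 'e, 'a) mixed_graph \<Rightarrow> nat" where
  "num_mixed_components G =
     card {H. mixed_component H G} + card {H. is_component H G \<and> arcs H = {}}"

end

theory Submission
  imports Defs
begin

text \<open>
  The integrated adjacency matrix of \<open>G\<close> is the adjacency matrix of an undirected graph, the double
  cover of \<open>G\<close>: every vertex \<open>u\<close> has two copies \<open>(u, True)\<close> and \<open>(u, False)\<close>, an edge joins copies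
  on the same side, and an arc from \<open>u\<close> to \<open>v\<close> joins \<open>(u, True)\<close> to \<open>(v, False)\<close>. Regularity of \<open>G\<close>
  says that all rows of this nonnegative symmetric matrix sum to \<open>r\<close>.

  The spectral part is the classical statement on regular graphs. If \<open>M f = x f\<close> then
  \<open>\<Sum> M\<^sub>i\<^sub>j (f\<^sub>i - f\<^sub>j)\<^sup>2 = 2 (r - x) \<Sum> f\<^sub>i\<^sup>2\<close> (\<open>laplacian_quadratic_form\<close>). Hence no eigenvalue exceeds
  \<open>r\<close>, and the eigenvectors for \<open>r\<close> are the functions that are constant on the connected components
  of the double cover. As the matrix is symmetric, algebraic and geometric multiplicity agree, so the
  multiplicity of \<open>r\<close> is the number of these components (\<open>order_char_poly_row_sum\<close>).

  It remains to match the components of the double cover with the mixed components of \<open>G\<close>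
  (\<open>card_cover_classes\<close>). A forward arc changes the side from \<open>True\<close> to \<open>False\<close> and a backward arc
  changes it back, so the walks of the double cover are the walks of \<open>G\<close> whose arcs alternate in
  direction, and the sides of the two ends differ iff the number of arcs is odd. A component of the
  double cover that uses no arc is a one-sided copy of a component of the undirected part: a mixed
  component of type I on side \<open>True\<close>, of type II on side \<open>False\<close>. A component that uses an arc
  projects to a submixed graph of \<open>G\<close>, its shadow. Shadows are special, every special submixed graph
  lies in the shadow of the component that contains its arcs (\<open>special_submixed_shadow\<close>), and two
  shadows share no arc; so the shadows are exactly the maximal special submixed graphs, each coming
  from one component.
\<close>

section \<open>The multiplicity of an eigenvalue of a symmetric matrix\<close>

lemma char_poly_four_block_lower_left_zero:
  fixes A1 :: "'a :: idom mat"
  assumes A1: "A1 \<in> carrier_mat c c" and A2: "A2 \<in> carrier_mat c d"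
    and A4: "A4 \<in> carrier_mat d d"
  shows "char_poly (four_block_mat A1 A2 (0\<^sub>m d c) A4) = char_poly A1 * char_poly A4"
proof -
  let ?A = "four_block_mat A1 A2 (0\<^sub>m d c) A4"
  have "char_poly_matrix ?A =
      four_block_mat (char_poly_matrix A1) (map_mat (\<lambda>a. [:- a:]) A2) (0\<^sub>m d c) (char_poly_matrix A4)"
    by (rule eq_matI, insert A1 A2 A4, auto simp: one_poly_def char_poly_matrix_def)
  then show ?thesis
    unfolding char_poly_def
    by (simp, intro det_four_block_mat_lower_left_zero[where m = d]) (use A1 A2 A4 in auto)
qed

lemma char_poly_scalar_mat:
  "char_poly (x \<cdot>\<^sub>m 1\<^sub>m c :: 'a :: comm_ring_1 mat) = [:- x, 1:] ^ c"
proof -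
  have "char_poly (x \<cdot>\<^sub>m 1\<^sub>m c) = (\<Prod>a\<leftarrow>diag_mat (x \<cdot>\<^sub>m 1\<^sub>m c). [:- a, 1:])"
    by (rule char_poly_upper_triangular[of _ c]) auto
  also have "diag_mat (x \<cdot>\<^sub>m 1\<^sub>m c) = replicate c x"
    by (rule nth_equalityI) (auto simp: diag_mat_def)
  finally show ?thesis
    by simp
qed

text \<open>
  If the eigenspace consists of the functions that are constant on the classes of a labelling, its
  dimension is the number \<open>c\<close> of classes. To see that this is also the algebraic multiplicity, pass to
  the basis formed by the class indicators and by the unit vectors at the indices that are not chosen
  as representatives of their class. In this basis the matrix is block upper triangular with first
  block \<open>r\<close> times the identity of size \<open>c\<close>, and symmetry excludes \<open>r\<close> from the spectrum of the
  complementary block \<open>N\<close>.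
\<close>

lemma order_char_poly_eq_card_labels:
  fixes A :: "real mat" and label :: "nat \<Rightarrow> 'l"
  assumes A: "A \<in> carrier_mat m m" and sym: "transpose_mat A = A"
    and eig: "\<And>f. f \<in> carrier_vec m \<Longrightarrow>
      A *\<^sub>v f = r \<cdot>\<^sub>v f \<longleftrightarrow> (\<forall>i<m. \<forall>j<m. label i = label j \<longrightarrow> f $ i = f $ j)"
  shows "order r (char_poly A) = card (label ` {..<m})"
proof -
  define L where "L = label ` {..<m}"
  define c where "c = card L"
  define rep where "rep l = (SOME i. i < m \<and> label i = l)" for l
  have rep: "rep l < m \<and> label (rep l) = l" if "l \<in> L" for l
  proof -
    have "\<exists>i. i < m \<and> label i = l"
      using that by (auto simp: L_def)
    then show ?thesis
      unfolding rep_def by (rule someI_ex)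
  qed
  define \<sigma>s where "\<sigma>s = sorted_list_of_set (rep ` L) @ sorted_list_of_set ({..<m} - rep ` L)"
  define \<sigma> where "\<sigma> k = \<sigma>s ! k" for k
  have finL: "finite L"
    by (simp add: L_def)
  have repm: "rep ` L \<subseteq> {..<m}"
    using rep by auto
  have inj_rep: "inj_on rep L"
    by (metis inj_onI rep)
  have card_rep: "card (rep ` L) = c"
    using inj_rep by (simp add: c_def card_image)
  have cm: "c \<le> m"
    using card_mono[OF _ repm] card_rep by simp
  have set_\<sigma>s: "set \<sigma>s = {..<m}"
    unfolding \<sigma>s_def using finL repm by auto
  have dist: "distinct \<sigma>s"
    unfolding \<sigma>s_def using finL by auto
  have len: "length \<sigma>s = m"
    using distinct_card[OF dist] set_\<sigma>s by simp
  have \<sigma>_lt: "\<sigma> k < m" if "k < m" for k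
    using that set_\<sigma>s len nth_mem[of k \<sigma>s] by (auto simp: \<sigma>_def)
  have \<sigma>_eq: "\<sigma> k = \<sigma> l \<longleftrightarrow> k = l" if "k < m" "l < m" for k l
    using that dist len by (simp add: \<sigma>_def nth_eq_iff_index_eq)
  have \<sigma>_surj: "\<exists>k<m. \<sigma> k = i" if "i < m" for i
    using that set_\<sigma>s len by (metis \<sigma>_def in_set_conv_nth lessThan_iff)
  have \<sigma>_rep: "\<sigma> k \<in> rep ` L \<longleftrightarrow> k < c" if "k < m" for k
  proof (cases "k < c")
    case True
    then have "\<sigma> k \<in> set (sorted_list_of_set (rep ` L))"
      unfolding \<sigma>_def \<sigma>s_def using card_rep by (simp add: nth_append)
    then show ?thesis
      using True finL by simp
  next
    case False
    then have "\<sigma> k = sorted_list_of_set ({..<m} - rep ` L) ! (k - c)"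
      unfolding \<sigma>_def \<sigma>s_def using card_rep by (simp add: nth_append)
    moreover have "k - c < length (sorted_list_of_set ({..<m} - rep ` L))"
      using that False card_rep repm finL by (simp add: card_Diff_subset)
    ultimately have "\<sigma> k \<in> set (sorted_list_of_set ({..<m} - rep ` L))"
      using nth_mem by metis
    then show ?thesis
      using False by simp
  qed
  have label_L: "label i \<in> L" if "i < m" for i
    using that by (auto simp: L_def)
  have \<sigma>_is_rep: "rep (label (\<sigma> k)) = \<sigma> k" if "k < c" for k
    using \<sigma>_rep[of k] that cm rep by force
  have rep_\<sigma>: "\<exists>k<c. \<sigma> k = rep l" if "l \<in> L" for l
    using \<sigma>_surj[of "rep l"] rep[OF that] \<sigma>_rep that by (metis imageI)
  \<comment> \<open>The first \<open>c\<close> indices of the enumeration \<open>\<sigma>\<close> are the representatives. The columns of \<open>P\<close> are the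
    new basis, and \<open>Q\<close> is its inverse: it keeps the entries at representatives
    and subtracts them from the other entries of their class.\<close>
  define P :: "real mat" where "P = mat m m (\<lambda>(i, k).
    if k < c then of_bool (label i = label (\<sigma> k)) else of_bool (i = \<sigma> k))"
  define Q :: "real mat" where "Q = mat m m (\<lambda>(k, i).
    if k < c then of_bool (i = \<sigma> k)
    else of_bool (i = \<sigma> k) - of_bool (i = rep (label (\<sigma> k))))"
  have P: "P \<in> carrier_mat m m" and Q: "Q \<in> carrier_mat m m"
    by (simp_all add: P_def Q_def)
  have QP: "Q * P = 1\<^sub>m m"
  proof (rule eq_matI)
    fix k l
    assume "k < dim_row (1\<^sub>m m)" "l < dim_col (1\<^sub>m m)"
    then have k: "k < m" and l: "l < m"
      by auto
    let ?p = "\<lambda>i. if l < c then of_bool (label i = label (\<sigma> l)) else of_bool (i = \<sigma> l) :: real"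
    have eq: "(Q * P) $$ (k, l) = (\<Sum>i<m. (if k < c then of_bool (i = \<sigma> k)
        else of_bool (i = \<sigma> k) - of_bool (i = rep (label (\<sigma> k)))) * ?p i)"
      using k l unfolding P_def Q_def
      by (simp add: scalar_prod_def atLeast0LessThan)
    have pick: "(\<Sum>i<m. of_bool (i = j) * ?p i) = ?p j" if "j < m" for j
    proof -
      have "(\<Sum>i<m. of_bool (i = j) * ?p i) = (\<Sum>i<m. if i = j then ?p i else 0)"
        by (rule sum.cong) auto
      also have "\<dots> = ?p j"
        using that by (subst sum.delta) auto
      finally show ?thesis .
    qed
    have "(Q * P) $$ (k, l) = (if k < c then ?p (\<sigma> k) else ?p (\<sigma> k) - ?p (rep (label (\<sigma> k))))"
    proof (cases "k < c")
      case True
      then show ?thesis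
        unfolding eq using pick[of "\<sigma> k"] \<sigma>_lt[OF k] by simp
    next
      case False
      have "rep (label (\<sigma> k)) < m"
        using rep label_L \<sigma>_lt k by blast
      then show ?thesis
        unfolding eq using False pick[of "\<sigma> k"] pick[of "rep (label (\<sigma> k))"] \<sigma>_lt[OF k]
        by (simp add: left_diff_distrib sum_subtractf)
    qed
    also have "\<dots> = of_bool (k = l)"
    proof (cases "l < c")
      case True
      have "label (\<sigma> k) = label (\<sigma> l) \<longleftrightarrow> k = l" if "k < c"
        using \<sigma>_is_rep[OF that] \<sigma>_is_rep[OF True] \<sigma>_eq[OF k l] by metis
      moreover have "label (rep (label (\<sigma> k))) = label (\<sigma> k)"
        using rep label_L \<sigma>_lt k by blast
      ultimately show ?thesis
        using True by auto
    next
      case False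
      have "rep (label (\<sigma> k)) \<noteq> \<sigma> l"
        using \<sigma>_rep[OF l] False label_L[OF \<sigma>_lt[OF k]] by (metis imageI)
      then show ?thesis
        using False \<sigma>_eq[OF k l] by auto
    qed
    finally show "(Q * P) $$ (k, l) = 1\<^sub>m m $$ (k, l)"
      using k l by simp
  qed (use P Q in auto)
  have PQ: "P * Q = 1\<^sub>m m"
    by (rule mat_mult_left_right_inverse[OF Q P QP])
  define B where "B = Q * A * P"
  have B: "B \<in> carrier_mat m m"
    using A P Q by (simp add: B_def)
  have PB: "P * B = A * P"
  proof -
    have "P * B = P * Q * (A * P)"
      using A P Q by (simp add: B_def assoc_mult_mat[of _ m m _ m _ m])
    then show ?thesis
      using A P by (simp add: PQ)
  qed
  have "A = P * B * Q"
    using A P Q by (simp add: PB assoc_mult_mat[of _ m m _ m _ m] PQ)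
  then have "similar_mat A B"
    using A B P Q PQ QP by (intro similar_matI[of _ _ P Q m]) auto
  then have cpAB: "char_poly A = char_poly B"
    by (rule char_poly_similar)
  have P_apply: "(P *\<^sub>v z) $ i = (\<Sum>k<m. (if k < c then of_bool (label i = label (\<sigma> k))
      else of_bool (i = \<sigma> k)) * z $ k)" if "i < m" "z \<in> carrier_vec m" for i z
    using that by (simp add: P_def scalar_prod_def atLeast0LessThan)
  have low: "A *\<^sub>v (P *\<^sub>v z) = r \<cdot>\<^sub>v (P *\<^sub>v z)"
    if z: "z \<in> carrier_vec m" and z0: "\<And>k. k < m \<Longrightarrow> c \<le> k \<Longrightarrow> z $ k = 0" for z
  proof (subst eig)
    show "\<forall>i<m. \<forall>j<m. label i = label j \<longrightarrow> (P *\<^sub>v z) $ i = (P *\<^sub>v z) $ j"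
      by (auto simp: P_apply z z0 intro!: sum.cong)
  qed (use P z in auto)
  have BQ: "B *\<^sub>v z = Q *\<^sub>v (A *\<^sub>v (P *\<^sub>v z))" if "z \<in> carrier_vec m" for z
    using that A P Q by (simp add: B_def assoc_mult_mat_vec[of _ m m _ m])
  have QPv: "Q *\<^sub>v (P *\<^sub>v z) = z" if "z \<in> carrier_vec m" for z
    using that P Q QP by (simp flip: assoc_mult_mat_vec[of _ m m _ m])
  have Bcol: "B $$ (i, l) = (if i = l then r else 0)" if "i < m" "l < c" for i l
  proof -
    have "col B l = B *\<^sub>v unit_vec m l"
      using B that cm by (intro eq_vecI) auto
    also have "\<dots> = r \<cdot>\<^sub>v unit_vec m l"
      using that cm P Q by (simp add: BQ low QPv mult_mat_vec[of _ m m])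
    finally have "col B l $ i = (r \<cdot>\<^sub>v unit_vec m l) $ i"
      by simp
    then show ?thesis
      using that cm B by simp
  qed
  define N where "N = mat (m - c) (m - c) (\<lambda>(i, j). B $$ (i + c, j + c))"
  define B2 where "B2 = mat c (m - c) (\<lambda>(i, j). B $$ (i, j + c))"
  have N: "N \<in> carrier_mat (m - c) (m - c)"
    by (simp add: N_def)
  have Bblock: "B = four_block_mat (r \<cdot>\<^sub>m 1\<^sub>m c) B2 (0\<^sub>m (m - c) c) N"
    using B cm by (intro eq_matI) (auto simp: Bcol N_def B2_def)
  have cpB: "char_poly B = [:- r, 1:] ^ c * char_poly N"
    by (subst Bblock, subst char_poly_four_block_lower_left_zero)
      (auto simp: N_def B2_def char_poly_scalar_mat)
  have "\<not> eigenvalue N r"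
  proof
    assume "eigenvalue N r"
    then obtain y where y: "y \<in> carrier_vec (m - c)" "y \<noteq> 0\<^sub>v (m - c)" "N *\<^sub>v y = r \<cdot>\<^sub>v y"
      by (auto simp: eigenvalue_def eigenvector_def N_def)
    define z where "z = vec m (\<lambda>k. if k < c then 0 else y $ (k - c))"
    define g0 where "g0 = vec m (\<lambda>k. if k < c then (B *\<^sub>v z) $ k else 0)"
    define f where "f = P *\<^sub>v z"
    \<comment> \<open>Lift \<open>y\<close> to a function \<open>f\<close> that vanishes at the representatives. Then \<open>A f = g + r f\<close> with \<open>g\<close>
      constant on classes, and \<open>g\<close> is orthogonal to itself because \<open>A - r\<close> is symmetric and kills \<open>g\<close>.
      So \<open>f\<close> is itself constant on classes and therefore zero.\<close>
    define g where "g = P *\<^sub>v g0"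
    have z: "z \<in> carrier_vec m" and g0: "g0 \<in> carrier_vec m"
      by (simp_all add: z_def g0_def)
    have f: "f \<in> carrier_vec m" and g: "g \<in> carrier_vec m"
      using P z g0 by (auto simp: f_def g_def)
    have Bz: "B *\<^sub>v z = g0 + r \<cdot>\<^sub>v z"
    proof (rule eq_vecI)
      fix k
      assume "k < dim_vec (g0 + r \<cdot>\<^sub>v z)"
      then have k: "k < m"
        by (simp add: z_def)
      show "(B *\<^sub>v z) $ k = (g0 + r \<cdot>\<^sub>v z) $ k"
      proof (cases "k < c")
        case True
        then show ?thesis
          using k by (simp add: g0_def z_def)
      next
        case False
        have "(B *\<^sub>v z) $ k = (\<Sum>j<m. B $$ (k, j) * z $ j)"
          using B k z by (simp add: scalar_prod_def atLeast0LessThan)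
        also have "\<dots> = (\<Sum>j\<in>{c..<m}. B $$ (k, j) * z $ j)"
          by (intro sum.mono_neutral_right) (auto simp: z_def)
        also have "\<dots> = (\<Sum>j\<in>{0..<m - c}. B $$ (k, j + c) * z $ (j + c))"
          using cm sum.shift_bounds_nat_ivl[of "\<lambda>j. B $$ (k, j) * z $ j" 0 c "m - c"] by simp
        also have "\<dots> = (N *\<^sub>v y) $ (k - c)"
          using k False y(1) by (auto simp: N_def z_def scalar_prod_def intro!: sum.cong)
        finally show ?thesis
          using k False y(1) by (simp add: y(3) g0_def z_def)
      qed
    qed (use B z in auto)
    have Af: "A *\<^sub>v f = g + r \<cdot>\<^sub>v f"
    proof -
      have "A *\<^sub>v f = P *\<^sub>v (B *\<^sub>v z)"
        unfolding f_def assoc_mult_mat_vec[OF A P z, symmetric] PB[symmetric]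
        by (rule assoc_mult_mat_vec[OF P B z])
      also have "\<dots> = g + r \<cdot>\<^sub>v f"
        using P g0 z by (simp add: Bz f_def g_def mult_add_distrib_mat_vec[of _ m m] mult_mat_vec[of _ m m])
      finally show ?thesis .
    qed
    have Ag: "A *\<^sub>v g = r \<cdot>\<^sub>v g"
      unfolding g_def by (rule low[OF g0]) (simp add: g0_def)
    have "(A *\<^sub>v f) \<bullet> g = f \<bullet> (A *\<^sub>v g)"
      using transpose_vec_mult_scalar[OF A f g] sym A f g
      by (metis carrier_matD(1) comm_scalar_prod mult_mat_vec_carrier)
    then have "g \<bullet> g = 0"
      using f g by (simp add: Af Ag add_scalar_prod_distrib[of _ m])
    then have "g = 0\<^sub>v m"
      using g conjugate_square_eq_0_vec[OF g] by simp
    then have "A *\<^sub>v f = r \<cdot>\<^sub>v f"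
      using f by (simp add: Af)
    then have const: "f $ i = f $ j" if "i < m" "j < m" "label i = label j" for i j
      using eig[OF f] that by blast
    have f_rep: "f $ \<sigma> k = 0" if k: "k < c" for k
    proof -
      have "f $ \<sigma> k = (\<Sum>j<m. (if j < c then of_bool (label (\<sigma> k) = label (\<sigma> j))
          else of_bool (\<sigma> k = \<sigma> j)) * z $ j)"
        unfolding f_def using \<sigma>_lt k cm z by (intro P_apply) auto
      also have "\<dots> = 0"
        using k cm \<sigma>_eq by (intro sum.neutral) (auto simp: z_def)
      finally show ?thesis .
    qed
    have "f $ i = 0" if i: "i < m" for i
    proof -
      obtain k where "k < c" "\<sigma> k = rep (label i)"
        using rep_\<sigma> label_L[OF i] by blast
      moreover have "rep (label i) < m" "label (rep (label i)) = label i"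
        using rep label_L[OF i] by auto
      ultimately show ?thesis
        using const[of i "rep (label i)"] f_rep[of k] i by simp
    qed
    then have "f = 0\<^sub>v m"
      using f by (intro eq_vecI) auto
    then have "z = 0\<^sub>v m"
      using QPv[OF z] Q by (intro eq_vecI) (auto simp: f_def)
    have "y $ k = 0" if "k < m - c" for k
    proof -
      have "y $ k = z $ (k + c)"
        using that by (simp add: z_def)
      then show ?thesis
        using \<open>z = 0\<^sub>v m\<close> that by simp
    qed
    then have "y = 0\<^sub>v (m - c)"
      using y(1) by (intro eq_vecI) auto
    with y(2) show False ..
  qed
  then have nz: "poly (char_poly N) r \<noteq> 0"
    using eigenvalue_root_char_poly[OF N] by simp
  then have "char_poly N \<noteq> 0"
    by auto
  then have "order r (char_poly B) = c + order r (char_poly N)"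
    unfolding cpB by (subst order_mult) (auto simp: order_power_n_n)
  then show ?thesis
    using nz by (simp add: cpAB order_0I c_def L_def)
qed

section \<open>Nonnegative symmetric matrices with constant row sums\<close>

lemma laplacian_quadratic_form:
  fixes A :: "real mat"
  assumes A: "A \<in> carrier_mat m m"
    and sym: "\<And>i j. i < m \<Longrightarrow> j < m \<Longrightarrow> A $$ (i, j) = A $$ (j, i)"
    and rows: "\<And>i. i < m \<Longrightarrow> (\<Sum>j<m. A $$ (i, j)) = r"
    and f: "f \<in> carrier_vec m" and eig: "A *\<^sub>v f = x \<cdot>\<^sub>v f"
  shows "(\<Sum>i<m. \<Sum>j<m. A $$ (i, j) * (f $ i - f $ j)\<^sup>2) = 2 * (r - x) * (\<Sum>i<m. (f $ i)\<^sup>2)"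
proof -
  have Af: "(\<Sum>j<m. A $$ (i, j) * f $ j) = x * f $ i" if i: "i < m" for i
  proof -
    have "(\<Sum>j<m. A $$ (i, j) * f $ j) = (A *\<^sub>v f) $ i"
      using A f i by (simp add: scalar_prod_def atLeast0LessThan)
    then show ?thesis
      using f i by (simp add: eig)
  qed
  have 1: "(\<Sum>i<m. \<Sum>j<m. A $$ (i, j) * (f $ i)\<^sup>2) = r * (\<Sum>i<m. (f $ i)\<^sup>2)"
    by (simp add: rows sum_distrib_left flip: sum_distrib_right)
  have 2: "(\<Sum>i<m. \<Sum>j<m. A $$ (i, j) * (f $ j)\<^sup>2) = r * (\<Sum>i<m. (f $ i)\<^sup>2)"
  proof -
    have "(\<Sum>i<m. A $$ (i, j) * (f $ j)\<^sup>2) = r * (f $ j)\<^sup>2" if "j < m" for j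
      using that rows[OF that] by (simp add: sym[of _ j] flip: sum_distrib_right)
    then show ?thesis
      by (subst sum.swap) (simp add: sum_distrib_left)
  qed
  have 3: "(\<Sum>i<m. \<Sum>j<m. A $$ (i, j) * (f $ i * f $ j)) = x * (\<Sum>i<m. (f $ i)\<^sup>2)"
  proof -
    have "(\<Sum>j<m. A $$ (i, j) * (f $ i * f $ j)) = x * (f $ i)\<^sup>2" if "i < m" for i
    proof -
      have "(\<Sum>j<m. A $$ (i, j) * (f $ i * f $ j)) = f $ i * (\<Sum>j<m. A $$ (i, j) * f $ j)"
        by (simp add: sum_distrib_left ac_simps)
      then show ?thesis
        using that by (simp add: Af power2_eq_square)
    qed
    then show ?thesis
      by (simp add: sum_distrib_left)
  qed
  have "(\<Sum>i<m. \<Sum>j<m. A $$ (i, j) * (f $ i - f $ j)\<^sup>2) =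
      (\<Sum>i<m. \<Sum>j<m. A $$ (i, j) * (f $ i)\<^sup>2 + A $$ (i, j) * (f $ j)\<^sup>2
        - 2 * (A $$ (i, j) * (f $ i * f $ j)))"
    by (intro sum.cong refl) (simp add: power2_diff algebra_simps)
  also have "\<dots> = r * (\<Sum>i<m. (f $ i)\<^sup>2) + r * (\<Sum>i<m. (f $ i)\<^sup>2) - 2 * (x * (\<Sum>i<m. (f $ i)\<^sup>2))"
    by (simp only: sum.distrib sum_subtractf 1 2 3 flip: sum_distrib_left)
  finally show ?thesis
    by (simp add: algebra_simps)
qed

lemma eigenvalue_le_row_sum:
  fixes A :: "real mat"
  assumes A: "A \<in> carrier_mat m m"
    and sym: "\<And>i j. i < m \<Longrightarrow> j < m \<Longrightarrow> A $$ (i, j) = A $$ (j, i)"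
    and rows: "\<And>i. i < m \<Longrightarrow> (\<Sum>j<m. A $$ (i, j)) = r"
    and nonneg: "\<And>i j. i < m \<Longrightarrow> j < m \<Longrightarrow> A $$ (i, j) \<ge> 0"
    and "eigenvalue A x"
  shows "x \<le> r"
proof -
  obtain f where f: "f \<in> carrier_vec m" "f \<noteq> 0\<^sub>v m" "A *\<^sub>v f = x \<cdot>\<^sub>v f"
    using assms(5) A by (auto simp: eigenvalue_def eigenvector_def)
  have "0 \<le> (\<Sum>i<m. \<Sum>j<m. A $$ (i, j) * (f $ i - f $ j)\<^sup>2)"
    using nonneg by (intro sum_nonneg mult_nonneg_nonneg) auto
  also have "\<dots> = 2 * (r - x) * (\<Sum>i<m. (f $ i)\<^sup>2)"
    by (rule laplacian_quadratic_form[OF A sym rows f(1,3)])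
  finally have *: "0 \<le> (r - x) * (\<Sum>i<m. (f $ i)\<^sup>2)"
    by (simp only: mult.assoc)
  obtain i where "i < m" "f $ i \<noteq> 0"
    using f(1,2) by (metis eq_vecI carrier_vecD index_zero_vec)
  then have "(\<Sum>i<m. (f $ i)\<^sup>2) > 0"
    by (intro sum_pos2[of _ i]) auto
  with * show ?thesis
    by (simp add: zero_le_mult_iff)
qed

text \<open>
  By the quadratic form, an eigenvector for the row sum takes equal values at indices joined by a
  nonzero entry, hence it is constant on the classes that the nonzero entries generate.
\<close>

lemma order_char_poly_row_sum:
  fixes A :: "real mat" and label :: "nat \<Rightarrow> 'l"
  assumes A: "A \<in> carrier_mat m m"
    and sym: "\<And>i j. i < m \<Longrightarrow> j < m \<Longrightarrow> A $$ (i, j) = A $$ (j, i)"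
    and rows: "\<And>i. i < m \<Longrightarrow> (\<Sum>j<m. A $$ (i, j)) = r"
    and nonneg: "\<And>i j. i < m \<Longrightarrow> j < m \<Longrightarrow> A $$ (i, j) \<ge> 0"
    and label: "\<And>i j. i < m \<Longrightarrow> j < m \<Longrightarrow>
      label i = label j \<longleftrightarrow> (i, j) \<in> {(i, j). i < m \<and> j < m \<and> A $$ (i, j) \<noteq> 0}\<^sup>*"
  shows "order r (char_poly A) = card (label ` {..<m})"
proof (rule order_char_poly_eq_card_labels[OF A])
  show "transpose_mat A = A"
    using A sym by (intro eq_matI) auto
next
  fix f :: "real vec"
  assume f: "f \<in> carrier_vec m"
  let ?E = "{(i, j). i < m \<and> j < m \<and> A $$ (i, j) \<noteq> 0}"
  show "A *\<^sub>v f = r \<cdot>\<^sub>v f \<longleftrightarrow> (\<forall>i<m. \<forall>j<m. label i = label j \<longrightarrow> f $ i = f $ j)"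
  proof
    assume "A *\<^sub>v f = r \<cdot>\<^sub>v f"
    then have "(\<Sum>i<m. \<Sum>j<m. A $$ (i, j) * (f $ i - f $ j)\<^sup>2) = 0"
      using laplacian_quadratic_form[OF A sym rows f] by simp
    then have "(\<Sum>j<m. A $$ (i, j) * (f $ i - f $ j)\<^sup>2) = 0" if "i < m" for i
      using that nonneg by (subst (asm) sum_nonneg_eq_0_iff) (auto intro!: sum_nonneg mult_nonneg_nonneg)
    then have "A $$ (i, j) * (f $ i - f $ j)\<^sup>2 = 0" if "i < m" "j < m" for i j
      using that nonneg sum_nonneg_0[of "{..<m}" "\<lambda>j. A $$ (i, j) * (f $ i - f $ j)\<^sup>2" j] by simp
    then have edge: "f $ i = f $ j" if "(i, j) \<in> ?E" for i j
      using that by auto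
    have "f $ i = f $ j" if "(i, j) \<in> ?E\<^sup>*" for i j
      using that
    proof (induction rule: rtrancl_induct)
      case (step k l)
      then show ?case
        using edge[OF step.hyps(2)] by simp
    qed simp
    then show "\<forall>i<m. \<forall>j<m. label i = label j \<longrightarrow> f $ i = f $ j"
      using label by blast
  next
    assume const: "\<forall>i<m. \<forall>j<m. label i = label j \<longrightarrow> f $ i = f $ j"
    show "A *\<^sub>v f = r \<cdot>\<^sub>v f"
    proof (rule eq_vecI)
      fix i
      assume "i < dim_vec (r \<cdot>\<^sub>v f)"
      then have i: "i < m"
        using f by simp
      have "f $ j = f $ i" if "j < m" "A $$ (i, j) \<noteq> 0" for j
      proof -
        have "(i, j) \<in> ?E\<^sup>*"
          using i that by (intro r_into_rtrancl) auto
        then have "label i = label j"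
          by (rule label[OF i that(1), THEN iffD2])
        then have "f $ i = f $ j"
          using const i that(1) by blast
        then show ?thesis
          by simp
      qed
      then have "(\<Sum>j<m. A $$ (i, j) * f $ j) = (\<Sum>j<m. A $$ (i, j) * f $ i)"
        by (intro sum.cong) auto
      also have "\<dots> = r * f $ i"
        using rows[OF i] by (simp flip: sum_distrib_right)
      finally show "(A *\<^sub>v f) $ i = (r \<cdot>\<^sub>v f) $ i"
        using A f i by (simp add: scalar_prod_def atLeast0LessThan)
    qed (use A f in auto)
  qed
qed

lemma lambda_1_eqI:
  assumes A: "A \<in> carrier_mat m m" and ev: "eigenvalue A r"
    and ub: "\<And>x. eigenvalue A x \<Longrightarrow> x \<le> r"
  shows "lambda A 1 = r"
proof -
  define xs where "xs = sorted_list_of_multiset (proots (char_poly A))"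
  have nz: "char_poly A \<noteq> 0"
    using degree_monic_char_poly[OF A] by (metis leading_coeff_0_iff zero_neq_one)
  have "set xs = {x. eigenvalue A x}"
    using nz by (simp add: xs_def eigenvalue_root_char_poly[OF A] flip: set_mset_mset)
  then have r: "r \<in> set xs" and le: "\<And>x. x \<in> set xs \<Longrightarrow> x \<le> r"
    using ev ub by auto
  have "sorted xs"
    by (simp add: xs_def)
  then have "r \<le> last xs"
    using r by (induction xs) auto
  moreover have "last xs \<le> r"
    using le r by (metis last_in_set list.set_cases list.distinct(1))
  moreover have "rev xs ! 0 = last xs"
    using r by (cases xs rule: rev_cases) auto
  ultimately show ?thesis
    by (simp add: lambda_def eigenvalues_desc_def xs_def)
qed

section \<open>Walks and components\<close>

lemma walk_verts: "walk K u ss v \<Longrightarrow> u \<in> verts K \<and> v \<in> verts K"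
  by (induction K u ss v rule: walk.induct) auto

lemma walk_append:
  "walk K u ss v \<Longrightarrow> walk K v ts w \<Longrightarrow> walk K u (ss @ ts) w"
  by (induction K u ss v rule: walk.induct) auto

lemma traverses_verts:
  assumes "is_mixed_graph K" "traverses K u x v"
  shows "u \<in> verts K" "v \<in> verts K"
  using assms by (cases x; auto simp: is_mixed_graph_def doubleton_eq_iff)+

fun reverse_step :: "('e, 'a) step \<Rightarrow> ('e, 'a) step" where
  "reverse_step (Edge e) = Edge e"
| "reverse_step (Forward a) = Backward a"
| "reverse_step (Backward a) = Forward a"

lemma traverses_reverse: "traverses K v (reverse_step x) u \<longleftrightarrow> traverses K u x v"
  by (cases x) auto

lemma walk_reverse:
  "walk K u ss v \<Longrightarrow> walk K v (rev (map reverse_step ss)) u"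
proof (induction ss arbitrary: u)
  case (Cons x ss)
  then obtain w where w: "u \<in> verts K" "traverses K u x w" "walk K w ss v"
    by auto
  have "walk K w [reverse_step x] u"
    using w walk_verts[OF w(3)] traverses_reverse[of K w x u] by simp
  with Cons.IH[OF w(3)] show ?case
    by (auto intro: walk_append)
qed simp

lemma submixed_traverses:
  "submixed H K \<Longrightarrow> traverses H u x v \<Longrightarrow> traverses K u x v"
  by (cases x) (auto simp: submixed_def)

lemma walk_submixed:
  assumes "submixed H K"
  shows "walk H u ss v \<Longrightarrow> walk K u ss v"
proof (induction ss arbitrary: u)
  case (Cons x ss)
  then show ?case
    using assms submixed_traverses[OF assms] by (fastforce simp: submixed_def)
qed (use assms in \<open>auto simp: submixed_def\<close>)

lemma submixed_antisym: "submixed H K \<Longrightarrow> submixed K H \<Longrightarrow> H = K"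
  by (auto simp: submixed_def intro!: mixed_graph.equality)

lemma is_mixed_graph_undirected_part: "is_mixed_graph K \<Longrightarrow> is_mixed_graph (undirected_part K)"
  by (auto simp: is_mixed_graph_def undirected_part_def)

lemma submixed_undirected_part: "is_mixed_graph K \<Longrightarrow> submixed (undirected_part K) K"
  using is_mixed_graph_undirected_part
  by (auto simp: submixed_def undirected_part_def)

lemma walk_undirected_part:
  "walk (undirected_part K) u ss v \<longleftrightarrow> walk K u ss v \<and> arc_steps ss = []"
proof (induction ss arbitrary: u)
  case Nil
  then show ?case
    by (simp add: undirected_part_def arc_steps_def)
next
  case (Cons x ss)
  then show ?case
    by (cases x) (auto simp: undirected_part_def arc_steps_def)
qed

definition reach :: "('v, 'e, 'a) mixed_graph \<Rightarrow> 'v \<Rightarrow> 'v set" where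
  "reach K u = {v. \<exists>ss. walk K u ss v}"

definition component_of :: "('v, 'e, 'a) mixed_graph \<Rightarrow> 'v \<Rightarrow> ('v, 'e, 'a) mixed_graph" where
  "component_of K u = K\<lparr>verts := reach K u, edges := {e \<in> edges K. ends K e \<subseteq> reach K u},
     arcs := {a \<in> arcs K. tail K a \<in> reach K u}\<rparr>"

lemma reach_step:
  assumes "is_mixed_graph K" "v \<in> reach K u" "traverses K v x w"
  shows "w \<in> reach K u"
proof -
  obtain ss where "walk K u ss v"
    using assms(2) by (auto simp: reach_def)
  moreover have "walk K v [x] w"
    using assms(3) traverses_verts[OF assms(1,3)] by simp
  ultimately show ?thesis
    unfolding reach_def by (blast intro: walk_append)
qed

lemma reach_self: "u \<in> verts K \<Longrightarrow> u \<in> reach K u"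
  by (auto simp: reach_def intro!: exI[of _ "[]"])

lemma reach_subset: "reach K u \<subseteq> verts K"
  by (auto simp: reach_def dest: walk_verts)

lemma reach_induct [consumes 2, case_names start step]:
  assumes "is_mixed_graph K" "v \<in> reach K u" "P u"
    and "\<And>v x w. v \<in> reach K u \<Longrightarrow> P v \<Longrightarrow> traverses K v x w \<Longrightarrow> P w"
  shows "P v"
proof -
  obtain ss where "walk K u ss v"
    using assms(2) by (auto simp: reach_def)
  moreover have "walk K v' ss v \<Longrightarrow> v' \<in> reach K u \<Longrightarrow> P v' \<Longrightarrow> P v" for v' ss
    by (induction ss arbitrary: v') (auto intro: assms(4) reach_step[OF assms(1)])
  moreover have "u \<in> reach K u"
    using \<open>walk K u ss v\<close> walk_verts reach_self by metis
  ultimately show ?thesis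
    using assms(3) by blast
qed

lemma submixed_component_of:
  assumes K: "is_mixed_graph K" and u: "u \<in> verts K"
  shows "submixed (component_of K u) K"
proof -
  have "head K a \<in> reach K u" if "a \<in> arcs K" "tail K a \<in> reach K u" for a
    using reach_step[OF K that(2), of "Forward a"] that(1) by simp
  moreover have "\<exists>v\<in>reach K u. \<exists>w\<in>reach K u. ends K e = {v, w}"
    if "e \<in> edges K" "ends K e \<subseteq> reach K u" for e
    using that K unfolding is_mixed_graph_def by (metis insert_subset)
  ultimately show ?thesis
    using K reach_subset[of K u] reach_self[OF u] finite_subset
    by (auto simp: submixed_def component_of_def is_mixed_graph_def)
qed

lemma traverses_component_of:
  assumes "is_mixed_graph K" "v \<in> reach K u" "traverses K v x w"
  shows "traverses (component_of K u) v x w"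
proof -
  have "w \<in> reach K u"
    by (rule reach_step[OF assms])
  then show ?thesis
    using assms(2,3) by (cases x) (auto simp: component_of_def)
qed

lemma walk_component_of:
  assumes "is_mixed_graph K"
  shows "v \<in> reach K u \<Longrightarrow> walk K v ss w \<Longrightarrow> walk (component_of K u) v ss w"
proof (induction ss arbitrary: v)
  case Nil
  then show ?case
    by (simp add: component_of_def)
next
  case (Cons x ss)
  then obtain y where y: "traverses K v x y" "walk K y ss w"
    by auto
  with Cons show ?case
    using traverses_component_of[OF assms Cons.prems(1) y(1)] reach_step[OF assms Cons.prems(1) y(1)]
    by (auto simp: component_of_def)
qed

lemma mixed_connected_component_of:
  assumes K: "is_mixed_graph K"
  shows "mixed_connected (component_of K u)"
  unfolding mixed_connected_def
proof (intro ballI)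
  fix v w
  assume "v \<in> verts (component_of K u)" "w \<in> verts (component_of K u)"
  then have v: "v \<in> reach K u" and w: "w \<in> reach K u"
    by (simp_all add: component_of_def)
  then obtain ss ts where "walk K u ss v" "walk K u ts w"
    by (auto simp: reach_def)
  then show "\<exists>ss. walk (component_of K u) v ss w"
    using walk_component_of[OF K v] walk_append walk_reverse by metis
qed

lemma submixed_component_of_if_connected:
  assumes H: "submixed H K" "mixed_connected H" and u: "u \<in> verts H"
  shows "submixed H (component_of K u)"
proof -
  have v: "verts H \<subseteq> reach K u"
    using H u walk_submixed[OF H(1)] unfolding mixed_connected_def reach_def by blast
  moreover have "ends K e \<subseteq> verts H" if "e \<in> edges H" for e
    using that H(1) unfolding submixed_def is_mixed_graph_def by fastforce
  moreover have "tail K a \<in> verts H" if "a \<in> arcs H" for a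
    using that H(1) unfolding submixed_def is_mixed_graph_def by fastforce
  ultimately show ?thesis
    using H(1) by (auto simp: submixed_def component_of_def)
qed

lemma is_component_component_of:
  assumes K: "is_mixed_graph K" and u: "u \<in> verts K"
  shows "is_component (component_of K u) K"
  unfolding is_component_def
proof (intro conjI allI impI)
  fix L
  assume L: "submixed L K \<and> mixed_connected L \<and> submixed (component_of K u) L"
  have "u \<in> verts L"
    using L reach_self[OF u] by (auto simp: submixed_def component_of_def)
  then show "L = component_of K u"
    using L submixed_component_of_if_connected submixed_antisym by metis
qed (rule submixed_component_of[OF K u] mixed_connected_component_of[OF K])+

lemma component_eq_component_of:
  assumes H: "is_component H K" and K: "is_mixed_graph K" and u: "u \<in> verts H"
  shows "H = component_of K u"
proof -
  have "u \<in> verts K"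
    using H u by (auto simp: is_component_def submixed_def)
  then show ?thesis
    using H u submixed_component_of_if_connected[of H K u] submixed_component_of[OF K]
      mixed_connected_component_of[OF K]
    unfolding is_component_def by metis
qed

lemma component_nonempty: "is_component H K \<Longrightarrow> \<exists>u. u \<in> verts H"
  by (auto simp: is_component_def submixed_def is_mixed_graph_def)

lemma component_verts_inj:
  assumes K: "is_mixed_graph K" and "is_component H K" "is_component H' K" "verts H = verts H'"
  shows "H = H'"
  using assms component_nonempty component_eq_component_of by metis

section \<open>The double cover\<close>

text \<open>
  This tracks the side on which a walk of the double cover runs. The side \<open>True\<close> is the one that arcs
  leave forward; it corresponds to the first block of rows of the integrated adjacency matrix.
\<close>

fun lifts :: "bool \<Rightarrow> ('e, 'a) step list \<Rightarrow> bool \<Rightarrow> bool" where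
  "lifts s [] t \<longleftrightarrow> s = t"
| "lifts s (Edge e # ss) t \<longleftrightarrow> lifts s ss t"
| "lifts s (Forward a # ss) t \<longleftrightarrow> s \<and> lifts False ss t"
| "lifts s (Backward a # ss) t \<longleftrightarrow> \<not> s \<and> lifts True ss t"

lemma lifts_append: "lifts s ss t \<Longrightarrow> lifts t ts t' \<Longrightarrow> lifts s (ss @ ts) t'"
  by (induction s ss t rule: lifts.induct) auto

lemma lifts_Cons: "lifts s (x # ss) t \<longleftrightarrow> (\<exists>s'. lifts s [x] s' \<and> lifts s' ss t)"
  by (cases x) auto

lemma lifts_reverse: "lifts s ss t \<Longrightarrow> lifts t (rev (map reverse_step ss)) s"
  by (induction s ss t rule: lifts.induct) (auto intro: lifts_append)

lemma arc_steps_simps [simp]: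
  "arc_steps [] = []"
  "arc_steps (Edge e # ss) = arc_steps ss"
  "arc_steps (Forward a # ss) = Forward a # arc_steps ss"
  "arc_steps (Backward a # ss) = Backward a # arc_steps ss"
  by (simp_all add: arc_steps_def)

lemma arc_steps_append: "arc_steps (ss @ ts) = arc_steps ss @ arc_steps ts"
  by (simp add: arc_steps_def)

lemma arc_steps_reverse:
  "arc_steps (rev (map reverse_step ss)) = rev (map reverse_step (arc_steps ss))"
proof (induction ss)
  case (Cons x ss)
  then show ?case
    by (cases x) (auto simp: arc_steps_append)
qed simp

lemma lifts_no_arcs: "arc_steps ss = [] \<Longrightarrow> lifts s ss t \<longleftrightarrow> s = t"
  by (induction s ss t rule: lifts.induct) auto

lemma lifts_parity: "lifts s ss t \<Longrightarrow> s \<noteq> t \<longleftrightarrow> odd (length (arc_steps ss))"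
  by (induction s ss t rule: lifts.induct) auto

lemma ex_lifts_iff:
  "(\<exists>t. lifts s ss t) \<longleftrightarrow>
    successively (\<lambda>x y. is_forward x \<noteq> is_forward y) (arc_steps ss) \<and>
    (arc_steps ss \<noteq> [] \<longrightarrow> is_forward (hd (arc_steps ss)) = s)"
proof (induction ss arbitrary: s)
  case (Cons x ss)
  then show ?case
    by (cases x; cases s) (auto simp: successively_Cons)
next
  case Nil
  have "lifts s ([] :: ('a, 'b) step list) s"
    by simp
  then show ?case
    by auto
qed

text \<open>
  The direction of the first arc fixes the starting side, and each arc forces the direction of the
  next one.
\<close>

lemma alternating_iff_lifts:
  "alternating ss \<longleftrightarrow> arc_steps ss \<noteq> [] \<and> (\<exists>s t. lifts s ss t)"
  unfolding alternating_def ex_lifts_iff by auto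

definition cover_adj :: "('v, 'e, 'a) mixed_graph \<Rightarrow> (('v \<times> bool) \<times> ('v \<times> bool)) set" where
  "cover_adj K = {((u, s), (v, t)). \<exists>x. traverses K u x v \<and> lifts s [x] t}"

definition linked :: "('v, 'e, 'a) mixed_graph \<Rightarrow> (('v \<times> bool) \<times> ('v \<times> bool)) set" where
  "linked K = (cover_adj K)\<^sup>*"

lemma sym_cover_adj: "sym (cover_adj K)"
proof (rule symI, clarify)
  fix u s v t
  assume "((u, s), (v, t)) \<in> cover_adj K"
  then obtain x where "traverses K u x v" "lifts s [x] t"
    by (auto simp: cover_adj_def)
  then have "traverses K v (reverse_step x) u" "lifts t [reverse_step x] s"
    using traverses_reverse[of K v x u] lifts_reverse[of s "[x]" t] by auto
  then show "((v, t), (u, s)) \<in> cover_adj K"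
    by (auto simp: cover_adj_def)
qed

lemma equiv_linked: "equiv UNIV (linked K)"
  unfolding linked_def
  by (intro equivI refl_rtrancl sym_rtrancl sym_cover_adj trans_rtrancl subset_UNIV) simp

lemma linked_sym: "(p, q) \<in> linked K \<Longrightarrow> (q, p) \<in> linked K"
  using equiv_linked by (meson equivE symE)

lemma linked_trans: "(p, q) \<in> linked K \<Longrightarrow> (q, q') \<in> linked K \<Longrightarrow> (p, q') \<in> linked K"
  by (simp add: linked_def)

lemma linked_iff_walk:
  assumes K: "is_mixed_graph K" and v: "v \<in> verts K"
  shows "((u, s), (v, t)) \<in> linked K \<longleftrightarrow> (\<exists>ss. walk K u ss v \<and> lifts s ss t)"
proof
  assume "((u, s), (v, t)) \<in> linked K"
  then have "\<exists>ss. walk K (fst p) ss v \<and> lifts (snd p) ss t" if "p = (u, s)" for p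
    unfolding linked_def that[symmetric]
  proof (induction rule: converse_rtrancl_induct)
    case base
    then show ?case
      using v by (auto intro: exI[of _ "[]"])
  next
    case (step p q)
    then obtain x ss where "traverses K (fst p) x (fst q)" "lifts (snd p) [x] (snd q)"
      "walk K (fst q) ss v" "lifts (snd q) ss t"
      by (auto simp: cover_adj_def)
    then have "walk K (fst p) (x # ss) v \<and> lifts (snd p) (x # ss) t"
      using traverses_verts[OF K] lifts_Cons[of "snd p" x ss t] by auto
    then show ?case
      by blast
  qed
  then show "\<exists>ss. walk K u ss v \<and> lifts s ss t"
    by auto
next
  have "walk K u ss v \<Longrightarrow> lifts s ss t \<Longrightarrow> ((u, s), (v, t)) \<in> linked K" for ss
  proof (induction ss arbitrary: u s)
    case Nil
    then show ?case
      by (simp add: linked_def)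
  next
    case (Cons x ss)
    then obtain w s' where "traverses K u x w" "lifts s [x] s'" "((w, s'), (v, t)) \<in> linked K"
      by (auto simp: lifts_Cons[of s x ss t])
    then have "((u, s), (w, s')) \<in> cover_adj K"
      by (auto simp: cover_adj_def)
    then show ?case
      using \<open>((w, s'), (v, t)) \<in> linked K\<close>
      unfolding linked_def by (rule converse_rtrancl_into_rtrancl)
  qed
  then show "\<exists>ss. walk K u ss v \<and> lifts s ss t \<Longrightarrow> ((u, s), (v, t)) \<in> linked K"
    by blast
qed

lemma linked_submixed:
  assumes "submixed H K"
  shows "linked H \<subseteq> linked K"
  unfolding linked_def
  by (rule rtrancl_mono) (auto simp: cover_adj_def intro: submixed_traverses[OF assms])

lemma linked_arc: "a \<in> arcs K \<Longrightarrow> ((tail K a, True), (head K a, False)) \<in> linked K"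
  unfolding linked_def cover_adj_def
  by (intro r_into_rtrancl) (auto intro!: exI[of _ "Forward a"])

lemma linked_reach_undirected:
  assumes K: "is_mixed_graph K" and v: "v \<in> reach (undirected_part K) u"
  shows "((u, s), (v, s)) \<in> linked K"
proof -
  obtain ss where ss: "walk K u ss v" "arc_steps ss = []"
    using v by (auto simp: reach_def walk_undirected_part)
  moreover have "v \<in> verts K"
    using ss walk_verts by metis
  ultimately show ?thesis
    using linked_iff_walk[OF K] lifts_no_arcs by metis
qed

lemma linked_verts:
  assumes "is_mixed_graph K" "(p, q) \<in> linked K" "fst p \<in> verts K"
  shows "fst q \<in> verts K"
  using assms(2,3) unfolding linked_def
  by induction (auto simp: cover_adj_def dest: traverses_verts[OF assms(1)])

section \<open>Components of the double cover and their shadows\<close>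

definition cover_classes :: "('v, 'e, 'a) mixed_graph \<Rightarrow> ('v \<times> bool) set set" where
  "cover_classes G = (verts G \<times> UNIV) // linked G"

text \<open>
  The projection of a component \<open>C\<close> of the double cover to the mixed graph. An edge at a vertex of the
  projection lifts to an edge inside \<open>C\<close>, but an arc has only one lift, so its tail must occur in \<open>C\<close>
  on the side \<open>True\<close>.
\<close>

definition shadow :: "('v, 'e, 'a) mixed_graph \<Rightarrow> ('v \<times> bool) set \<Rightarrow> ('v, 'e, 'a) mixed_graph" where
  "shadow G C = G\<lparr>verts := fst ` C, edges := {e \<in> edges G. ends G e \<inter> fst ` C \<noteq> {}},
     arcs := {a \<in> arcs G. (tail G a, True) \<in> C}\<rparr>"

lemma cover_class_eq:
  assumes "C \<in> cover_classes G" "p \<in> C"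
  shows "C = linked G `` {p}"
  using assms equiv_linked[of G] unfolding cover_classes_def
  by (metis Image_singleton_iff equiv_class_eq quotientE)

lemma cover_class_closed:
  assumes "C \<in> cover_classes G" "p \<in> C"
  shows "q \<in> C \<longleftrightarrow> (p, q) \<in> linked G"
  using cover_class_eq[OF assms] by blast

lemma cover_classI: "u \<in> verts G \<Longrightarrow> linked G `` {(u, s)} \<in> cover_classes G"
  by (auto simp: cover_classes_def intro!: quotientI)

lemma mem_linked_class: "p \<in> linked G `` {p}"
  by (simp add: linked_def)

lemma cover_class_nonempty: "C \<in> cover_classes G \<Longrightarrow> \<exists>u s. (u, s) \<in> C"
  by (auto simp: cover_classes_def quotient_def linked_def)

lemma cover_class_verts:
  assumes "is_mixed_graph G" "C \<in> cover_classes G"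
  shows "fst ` C \<subseteq> verts G"
  using assms(2) linked_verts[OF assms(1)]
  by (fastforce simp: cover_classes_def quotient_def)

lemma finite_cover_classes: "is_mixed_graph G \<Longrightarrow> finite (cover_classes G)"
  by (simp add: cover_classes_def quotient_def is_mixed_graph_def)

lemma cover_class_arc:
  assumes "C \<in> cover_classes G" "a \<in> arcs G"
  shows "(head G a, False) \<in> C \<longleftrightarrow> (tail G a, True) \<in> C"
  using cover_class_closed[OF assms(1)] linked_arc[OF assms(2)] linked_sym by blast

lemma cover_class_traverses:
  assumes "C \<in> cover_classes G" "(u, s) \<in> C" "traverses G u x v" "lifts s [x] t"
  shows "(v, t) \<in> C"
proof -
  have "((u, s), (v, t)) \<in> linked G"
    using assms(3,4) unfolding linked_def cover_adj_def by (intro r_into_rtrancl) auto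
  then show ?thesis
    using cover_class_closed[OF assms(1,2)] by blast
qed

lemma shadow_ends:
  assumes "C \<in> cover_classes G" "e \<in> edges (shadow G C)" "ends G e = {u, v}"
  shows "\<exists>s. (u, s) \<in> C \<and> (v, s) \<in> C"
proof -
  have e: "e \<in> edges G" "traverses G u (Edge e) v" "traverses G v (Edge e) u"
    using assms(2,3) by (auto simp: shadow_def insert_commute)
  obtain s where "(u, s) \<in> C \<or> (v, s) \<in> C"
    using assms(2,3) by (fastforce simp: shadow_def)
  then show ?thesis
    using cover_class_traverses[OF assms(1) _ e(2), of s s]
      cover_class_traverses[OF assms(1) _ e(3), of s s] by auto
qed

lemma submixed_shadow:
  assumes G: "is_mixed_graph G" and C: "C \<in> cover_classes G"
  shows "submixed (shadow G C) G"
proof -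
  have "is_mixed_graph (shadow G C)"
    unfolding is_mixed_graph_def
  proof (intro conjI ballI)
    show "finite (verts (shadow G C))"
      using G cover_class_verts[OF G C] finite_subset
      by (auto simp: shadow_def is_mixed_graph_def)
    show "verts (shadow G C) \<noteq> {}"
      using cover_class_nonempty[OF C] by (auto simp: shadow_def)
  next
    fix e
    assume e: "e \<in> edges (shadow G C)"
    then have "e \<in> edges G"
      by (simp add: shadow_def)
    then obtain u v where uv: "ends G e = {u, v}"
      using G unfolding is_mixed_graph_def by blast
    then show "\<exists>u\<in>verts (shadow G C). \<exists>v\<in>verts (shadow G C). ends (shadow G C) e = {u, v}"
      using shadow_ends[OF C e uv] by (force simp: shadow_def)
  next
    fix a
    assume "a \<in> arcs (shadow G C)"
    then show "tail (shadow G C) a \<in> verts (shadow G C)" "head (shadow G C) a \<in> verts (shadow G C)"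
      using cover_class_arc[OF C, of a] by (force simp: shadow_def)+
  qed (use G in \<open>auto simp: shadow_def is_mixed_graph_def\<close>)
  then show ?thesis
    using cover_class_verts[OF G C] by (auto simp: submixed_def shadow_def)
qed

text \<open>
  The shadow keeps every edge and arc with a lift inside \<open>C\<close>, so \<open>C\<close> stays connected in the double
  cover of its shadow.
\<close>

lemma linked_shadow:
  assumes C: "C \<in> cover_classes G" and p: "p \<in> C" and q: "q \<in> C"
  shows "(p, q) \<in> linked (shadow G C)"
proof -
  have "(p, q) \<in> linked G"
    using cover_class_closed[OF C p] q by blast
  then have "q \<in> C \<and> (p, q) \<in> linked (shadow G C)"
    unfolding linked_def
  proof (induction rule: rtrancl_induct)
    case (step q q')
    then obtain u s v t x where q: "q = (u, s)" "q' = (v, t)"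
      and x: "traverses G u x v" "lifts s [x] t" and us: "(u, s) \<in> C"
      by (auto simp: cover_adj_def)
    have vt: "(v, t) \<in> C"
      by (rule cover_class_traverses[OF C us x])
    have "traverses (shadow G C) u x v"
      using x us vt by (cases x) (force simp: shadow_def)+
    then have "(q, q') \<in> cover_adj (shadow G C)"
      using x(2) by (auto simp: cover_adj_def q)
    with step vt show ?case
      by (auto simp: q)
  qed (use p in simp)
  then show ?thesis ..
qed

section \<open>Special submixed graphs\<close>

text \<open>
  In the double cover of \<open>K\<close>, the copies that are not live make up the components without arcs.
\<close>

definition live :: "('v, 'e, 'a) mixed_graph \<Rightarrow> 'v \<Rightarrow> bool \<Rightarrow> bool" where
  "live K u s \<longleftrightarrow> (\<exists>a\<in>arcs K. (if s then tail K a else head K a) \<in> reach (undirected_part K) u)"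

lemma live_if_arc_step:
  assumes K: "is_mixed_graph K"
  shows "walk K u ss v \<Longrightarrow> lifts s ss t \<Longrightarrow> arc_steps ss \<noteq> [] \<Longrightarrow> live K u s"
proof (induction ss arbitrary: u)
  case (Cons x ss)
  then obtain w where w: "u \<in> verts K" "traverses K u x w" "walk K w ss v"
    by auto
  have u: "u \<in> reach (undirected_part K) u"
    using w(1) by (intro reach_self) (simp add: undirected_part_def)
  show ?case
  proof (cases x)
    case (Edge e)
    then have "live K w s"
      using Cons w by auto
    then obtain a ts where a: "a \<in> arcs K"
      "walk (undirected_part K) w ts (if s then tail K a else head K a)"
      by (auto simp: live_def reach_def)
    moreover have "walk (undirected_part K) u (x # ts) (if s then tail K a else head K a)"
      using a(2) w(1,2) Edge by (auto simp: undirected_part_def)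
    ultimately show ?thesis
      unfolding live_def reach_def by blast
  next
    case (Forward a)
    then show ?thesis
      using Cons.prems w u by (auto simp: live_def)
  next
    case (Backward a)
    then show ?thesis
      using Cons.prems w u by (auto simp: live_def)
  qed
qed simp

lemma live_ends:
  assumes K: "is_mixed_graph K" and w: "walk K u ss v" "lifts s ss t" "arc_steps ss \<noteq> []"
  shows "live K u s" "live K v t"
proof -
  show "live K u s"
    by (rule live_if_arc_step[OF K w])
  show "live K v t"
    using live_if_arc_step[OF K walk_reverse[OF w(1)] lifts_reverse[OF w(2)]] w(3)
    by (simp add: arc_steps_reverse)
qed

lemma special_is_mixed_graph: "special K G \<Longrightarrow> is_mixed_graph K"
  by (simp add: special_def submixed_def)

text \<open>
  If both copies of \<open>u\<close> are live, the component of \<open>u\<close> in the undirected part contains the end of an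
  arc and the start of an arc. The closed walk with an odd number of arcs that a special submixed
  graph then provides leads from one copy of \<open>u\<close> to the other.
\<close>

lemma special_switch_sides:
  assumes K: "special K G" and live: "live K u s" "live K u (\<not> s)"
  shows "((u, s), (u, \<not> s)) \<in> linked K"
proof -
  have mg: "is_mixed_graph K"
    by (rule special_is_mixed_graph[OF K])
  let ?U = "undirected_part K"
  obtain a b where a: "a \<in> arcs K" "tail K a \<in> reach ?U u"
    and b: "b \<in> arcs K" "head K b \<in> reach ?U u"
    using live by (cases s) (auto simp: live_def)
  then have u: "u \<in> verts ?U"
    by (auto simp: reach_def dest: walk_verts)
  have "is_component (component_of ?U u) ?U"
    using is_component_component_of[OF is_mixed_graph_undirected_part[OF mg] u] .
  moreover have "verts (component_of ?U u) = reach ?U u"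
    by (simp add: component_of_def)
  ultimately obtain ss where ss: "alternating_walk K u ss u" "odd (length (arc_steps ss))"
    using K a b reach_self[OF u] unfolding special_def by metis
  then obtain s' t where "walk K u ss u" "lifts s' ss t"
    by (auto simp: alternating_walk_def alternating_iff_lifts)
  then have "((u, s'), (u, t)) \<in> linked K" "s' \<noteq> t"
    using linked_iff_walk[OF mg] lifts_parity ss(2) walk_verts by metis+
  then show ?thesis
    using linked_sym by (cases s; cases s'; cases t) auto
qed

text \<open>
  This is what being special means: the part of the double cover that uses arcs is connected. The
  alternating walk from \<open>u\<close> to \<open>v\<close> may start and end on the wrong sides, but its ends are live, so
  switching sides repairs this.
\<close>

lemma special_live_linked:
  assumes K: "special K G" and u: "u \<in> verts K" "live K u s" and v: "v \<in> verts K" "live K v t"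
  shows "((u, s), (v, t)) \<in> linked K"
proof -
  have mg: "is_mixed_graph K"
    by (rule special_is_mixed_graph[OF K])
  have same: "((w, s1), (w, s2)) \<in> linked K" if "live K w s1" "live K w s2" for w s1 s2
  proof (cases "s1 = s2")
    case True
    then show ?thesis
      by (simp add: linked_def)
  next
    case False
    then show ?thesis
      using special_switch_sides[OF K that(1)] that(2) by (cases s1; cases s2) auto
  qed
  show ?thesis
  proof (cases "u = v")
    case True
    then show ?thesis
      using same u v by blast
  next
    case False
    then obtain ss where "alternating_walk K u ss v"
      using K u(1) v(1) unfolding special_def by blast
    then obtain s' t' where w: "walk K u ss v" "lifts s' ss t'" "arc_steps ss \<noteq> []"
      by (auto simp: alternating_walk_def alternating_iff_lifts)
    then have "((u, s'), (v, t')) \<in> linked K"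
      using linked_iff_walk[OF mg v(1)] by blast
    then show ?thesis
      using same[OF u(2) live_ends(1)[OF mg w]] same[OF live_ends(2)[OF mg w] v(2)]
      by (blast intro: linked_trans)
  qed
qed

lemma live_tail:
  assumes "is_mixed_graph K" "a \<in> arcs K"
  shows "live K (tail K a) True"
proof -
  have "tail K a \<in> reach (undirected_part K) (tail K a)"
    using assms by (intro reach_self) (auto simp: undirected_part_def is_mixed_graph_def)
  then show ?thesis
    using assms(2) by (auto simp: live_def)
qed

lemma special_vertex_live:
  assumes K: "special K G" and v: "v \<in> verts K"
  shows "\<exists>s. live K v s"
proof -
  have mg: "is_mixed_graph K"
    by (rule special_is_mixed_graph[OF K])
  obtain a where a: "a \<in> arcs K"
    using K by (auto simp: special_def)
  show ?thesis
  proof (cases "v = tail K a")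
    case True
    then show ?thesis
      using live_tail[OF mg a] by blast
  next
    case False
    moreover have "tail K a \<in> verts K"
      using mg a by (simp add: is_mixed_graph_def)
    ultimately obtain ss where "alternating_walk K v ss (tail K a)"
      using K v unfolding special_def by blast
    then obtain s t where w: "walk K v ss (tail K a)" "lifts s ss t" "arc_steps ss \<noteq> []"
      by (auto simp: alternating_walk_def alternating_iff_lifts)
    show ?thesis
      using live_ends(1)[OF mg w] ..
  qed
qed

text \<open>
  Every vertex of \<open>K\<close> has a live copy, and all live copies are linked to the tail of the given arc, so
  \<open>C\<close> covers all of \<open>K\<close>.
\<close>

lemma special_submixed_shadow:
  assumes G: "is_mixed_graph G" and K: "special K G"
    and a: "a \<in> arcs K" and C: "C \<in> cover_classes G" "(tail G a, True) \<in> C"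
  shows "submixed K (shadow G C)"
proof -
  have mg: "is_mixed_graph K"
    by (rule special_is_mixed_graph[OF K])
  have sub: "submixed K G"
    using K by (simp add: special_def)
  then have inc: "ends K = ends G" "tail K = tail G" "head K = head G"
    "edges K \<subseteq> edges G" "arcs K \<subseteq> arcs G"
    by (simp_all add: submixed_def)
  have tail: "tail G b \<in> verts K" "live K (tail G b) True" if "b \<in> arcs K" for b
    using mg that live_tail[OF mg that] by (simp_all add: is_mixed_graph_def inc)
  have inC: "(v, s) \<in> C" if "v \<in> verts K" "live K v s" for v s
  proof -
    have "((tail G a, True), (v, s)) \<in> linked G"
      using special_live_linked[OF K tail[OF a] that] linked_submixed[OF sub] by blast
    then show ?thesis
      using cover_class_closed[OF C] by blast
  qed
  have verts: "verts K \<subseteq> fst ` C"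
  proof
    fix v
    assume v: "v \<in> verts K"
    then obtain s where "live K v s"
      using special_vertex_live[OF K] by blast
    then have "(v, s) \<in> C"
      by (rule inC[OF v])
    then show "v \<in> fst ` C"
      by force
  qed
  have "ends G e \<inter> fst ` C \<noteq> {}" if "e \<in> edges K" for e
  proof -
    have "\<exists>u\<in>verts K. \<exists>v\<in>verts K. ends K e = {u, v}"
      using mg that by (simp add: is_mixed_graph_def)
    then obtain u v where "u \<in> verts K" "ends G e = {u, v}"
      unfolding inc(1) by blast
    moreover have "u \<in> fst ` C"
      using verts calculation(1) by (rule subsetD)
    ultimately show ?thesis
      by blast
  qed
  moreover have "(tail G b, True) \<in> C" if "b \<in> arcs K" for b
    using inC tail[OF that] by blast
  ultimately show ?thesis
    using mg inc verts by (auto simp: submixed_def shadow_def)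
qed

text \<open>
  Copies in \<open>C\<close> are joined by paths, which project to walks with alternating arcs. If a component of
  the undirected part of the shadow contains both the end and the start of an arc, then both copies of
  each of its vertices lie in \<open>C\<close>, and a path between them has an odd number of arcs.
\<close>

lemma special_shadow:
  assumes G: "is_mixed_graph G" and C: "C \<in> cover_classes G" and arcs: "arcs (shadow G C) \<noteq> {}"
  shows "special (shadow G C) G"
proof -
  let ?S = "shadow G C"
  have sub: "submixed ?S G"
    by (rule submixed_shadow[OF G C])
  then have mg: "is_mixed_graph ?S" and inc: "tail ?S = tail G" "head ?S = head G"
    by (simp_all add: submixed_def)
  obtain a where a: "a \<in> arcs ?S"
    using arcs by blast
  then have aC: "(tail G a, True) \<in> C"
    by (simp add: shadow_def)
  have walk_C: "\<exists>ss. walk ?S u ss v \<and> lifts s ss t" if "(u, s) \<in> C" "(v, t) \<in> C" for u s v t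
  proof -
    have "v \<in> verts ?S"
      using that by (force simp: shadow_def)
    then show ?thesis
      using linked_iff_walk[OF mg] linked_shadow[OF C that] by blast
  qed
  show ?thesis
    unfolding special_def
  proof (intro conjI ballI impI allI)
    fix u v
    assume "u \<in> verts ?S" "v \<in> verts ?S"
    then obtain s t where "(u, s) \<in> C" "(v, t) \<in> C"
      by (auto simp: shadow_def)
    then obtain ss ts where ss: "walk ?S u ss (tail G a)" "lifts s ss True"
      and ts: "walk ?S (tail G a) ts v" "lifts True ts t"
      using walk_C aC by meson
    \<comment> \<open>The detour along \<open>a\<close> and back makes sure that the walk contains an arc.\<close>
    let ?ts = "Forward a # Backward a # ts"
    have "tail G a \<in> verts ?S" "head G a \<in> verts ?S"
      using mg a by (auto simp: is_mixed_graph_def inc)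
    then have "walk ?S (tail G a) ?ts v"
      using a ts(1) by (simp add: inc)
    then have "walk ?S u (ss @ ?ts) v" "lifts s (ss @ ?ts) t"
      using ss ts(2) by (auto intro: walk_append lifts_append)
    moreover have "arc_steps (ss @ ?ts) \<noteq> []"
      by (simp add: arc_steps_append)
    ultimately show "\<exists>ss. alternating_walk ?S u ss v"
      unfolding alternating_walk_def alternating_iff_lifts by blast
  next
    fix H v
    assume H: "is_component H (undirected_part ?S) \<and>
      (\<exists>a\<in>arcs ?S. head ?S a \<in> verts H) \<and> (\<exists>a\<in>arcs ?S. tail ?S a \<in> verts H)"
      and v: "v \<in> verts H"
    have "H = component_of (undirected_part ?S) v"
      using H component_eq_component_of[OF _ is_mixed_graph_undirected_part[OF mg] v] by simp
    then have reach: "verts H = reach (undirected_part ?S) v"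
      by (simp add: component_of_def)
    have side: "((v, s), (w, s)) \<in> linked G" if "w \<in> verts H" for w s
      using linked_reach_undirected[OF mg] that linked_submixed[OF sub] unfolding reach by blast
    obtain b c where b: "b \<in> arcs ?S" "head G b \<in> verts H" and c: "c \<in> arcs ?S" "tail G c \<in> verts H"
      using H by (auto simp: inc)
    have "(head G b, False) \<in> C" "(tail G c, True) \<in> C"
      using b c cover_class_arc[OF C] by (auto simp: shadow_def)
    then have "(v, False) \<in> C" "(v, True) \<in> C"
      using side b(2) c(2) linked_sym cover_class_closed[OF C] by blast+
    then obtain ss where ss: "walk ?S v ss v" "lifts True ss False"
      using walk_C by blast
    then have "odd (length (arc_steps ss))"
      using lifts_parity by blast
    moreover have "arc_steps ss \<noteq> []"
      using calculation by auto
    ultimately show "\<exists>ss. alternating_walk ?S v ss v \<and> odd (length (arc_steps ss))"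
      unfolding alternating_walk_def alternating_iff_lifts using ss by blast
  qed (use sub arcs in auto)
qed

text \<open>
  A maximal special submixed graph equals the shadow that contains it. Conversely, a special submixed
  graph above a shadow contains an arc of that shadow, so it lies in the same shadow.
\<close>

lemma type_III_iff_shadow:
  assumes G: "is_mixed_graph G"
  shows "type_III H G \<longleftrightarrow> (\<exists>C\<in>cover_classes G. arcs (shadow G C) \<noteq> {} \<and> H = shadow G C)"
proof
  assume H: "type_III H G"
  then have sp: "special H G"
    by (simp add: type_III_def)
  then obtain a where a: "a \<in> arcs H"
    by (auto simp: special_def)
  then have aG: "a \<in> arcs G"
    using sp by (auto simp: special_def submixed_def)
  then have "tail G a \<in> verts G"
    using G by (simp add: is_mixed_graph_def)
  then have C: "linked G `` {(tail G a, True)} \<in> cover_classes G" (is "?C \<in> _")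
    by (rule cover_classI)
  have "submixed H (shadow G ?C)"
    by (rule special_submixed_shadow[OF G sp a C]) (rule mem_linked_class)
  moreover have arcs: "arcs (shadow G ?C) \<noteq> {}"
    using aG mem_linked_class by (fastforce simp: shadow_def)
  ultimately have "shadow G ?C = H"
    using H special_shadow[OF G C] by (simp add: type_III_def)
  with C arcs show "\<exists>C\<in>cover_classes G. arcs (shadow G C) \<noteq> {} \<and> H = shadow G C"
    by blast
next
  assume "\<exists>C\<in>cover_classes G. arcs (shadow G C) \<noteq> {} \<and> H = shadow G C"
  then obtain C where C: "C \<in> cover_classes G" and arcs: "arcs (shadow G C) \<noteq> {}"
    and H: "H = shadow G C"
    by blast
  obtain a where a: "a \<in> arcs (shadow G C)"
    using arcs by blast
  have "K = H" if K: "special K G" "submixed H K" for K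
  proof -
    have "a \<in> arcs K"
      using a K(2) by (auto simp: H submixed_def)
    then have "submixed K H"
      unfolding H by (rule special_submixed_shadow[OF G K(1) _ C]) (use a in \<open>simp add: shadow_def\<close>)
    then show ?thesis
      using K(2) submixed_antisym by blast
  qed
  then show "type_III H G"
    using special_shadow[OF G C arcs] by (auto simp: type_III_def H)
qed

text \<open>Each arc has a single lift, so shadows of different components have no common arc.\<close>

lemma inj_on_shadow: "inj_on (shadow G) {C \<in> cover_classes G. arcs (shadow G C) \<noteq> {}}"
proof (rule inj_onI)
  fix C D
  assume "C \<in> {C \<in> cover_classes G. arcs (shadow G C) \<noteq> {}}"
    and "D \<in> {C \<in> cover_classes G. arcs (shadow G C) \<noteq> {}}"
    and eq: "shadow G C = shadow G D"
  then have C: "C \<in> cover_classes G" and D: "D \<in> cover_classes G"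
    and "arcs (shadow G D) \<noteq> {}"
    by simp_all
  then obtain a where D_a: "a \<in> arcs (shadow G D)"
    by blast
  then have C_a: "a \<in> arcs (shadow G C)"
    by (simp only: eq)
  have "C = linked G `` {(tail G a, True)}"
    by (rule cover_class_eq[OF C]) (use C_a in \<open>simp add: shadow_def\<close>)
  moreover have "D = linked G `` {(tail G a, True)}"
    by (rule cover_class_eq[OF D]) (use D_a in \<open>simp add: shadow_def\<close>)
  ultimately show "C = D"
    by (rule trans[OF _ sym])
qed

section \<open>Counting the mixed components\<close>

text \<open>
  Types I and II are mirror images under exchanging the two sides; this notion treats them at once.
\<close>

definition bare_component :: "('v, 'e, 'a) mixed_graph \<Rightarrow> bool \<Rightarrow> ('v, 'e, 'a) mixed_graph \<Rightarrow> bool" where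
  "bare_component G s H \<longleftrightarrow> is_component H (undirected_part G) \<and>
     (\<forall>a\<in>arcs G. (if s then tail G a else head G a) \<notin> verts H)"

lemma out_degree_0_iff: "is_mixed_graph G \<Longrightarrow> out_degree G u = 0 \<longleftrightarrow> (\<forall>a\<in>arcs G. tail G a \<noteq> u)"
  by (auto simp: out_degree_def is_mixed_graph_def)

lemma in_degree_0_iff: "is_mixed_graph G \<Longrightarrow> in_degree G u = 0 \<longleftrightarrow> (\<forall>a\<in>arcs G. head G a \<noteq> u)"
  by (auto simp: in_degree_def is_mixed_graph_def)

lemma type_I_iff_bare: "is_mixed_graph G \<Longrightarrow> type_I H G \<longleftrightarrow> bare_component G True H"
  by (auto simp: type_I_def bare_component_def out_degree_0_iff)

lemma type_II_iff_bare: "is_mixed_graph G \<Longrightarrow> type_II H G \<longleftrightarrow> bare_component G False H"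
  by (auto simp: type_II_def bare_component_def in_degree_0_iff)

lemma bare_component_class:
  assumes G: "is_mixed_graph G" and H: "bare_component G s H" and u: "u \<in> verts H"
  shows "linked G `` {(u, s)} = verts H \<times> {s}"
proof (intro equalityI subsetI)
  let ?U = "undirected_part G"
  have "H = component_of ?U u"
    using H component_eq_component_of[OF _ is_mixed_graph_undirected_part[OF G] u]
    by (simp add: bare_component_def)
  then have verts: "verts H = reach ?U u"
    by (simp add: component_of_def)
  {
    fix q
    assume "q \<in> verts H \<times> {s}"
    then show "q \<in> linked G `` {(u, s)}"
      using linked_reach_undirected[OF G] by (auto simp: verts)
  next
    fix q
    assume "q \<in> linked G `` {(u, s)}"
    then have "((u, s), q) \<in> (cover_adj G)\<^sup>*"
      by (simp add: linked_def)
    then show "q \<in> verts H \<times> {s}"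
    proof (induction rule: rtrancl_induct)
      case base
      show ?case
        using u by simp
    next
      case (step p q)
      then obtain v w t x where p: "p = (v, s)" "v \<in> verts H" and q: "q = (w, t)"
        and x: "traverses G v x w" "lifts s [x] t"
        by (auto simp: cover_adj_def)
      show ?case
      proof (cases x)
        case (Edge e)
        then have "traverses ?U v x w"
          using x(1) by (auto simp: undirected_part_def)
        then have "w \<in> verts H"
          using reach_step[OF is_mixed_graph_undirected_part[OF G]] p(2) unfolding verts by blast
        then show ?thesis
          using x(2) Edge q by simp
      next
        case (Forward a)
        then show ?thesis
          using x H p(2) by (auto simp: bare_component_def)
      next
        case (Backward a)
        then show ?thesis
          using x H p(2) by (auto simp: bare_component_def)
      qed
    qed
  }
qed

lemma arcless_class_component:
  assumes G: "is_mixed_graph G" and C: "C \<in> cover_classes G" "(u, s) \<in> C"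
    and arcs: "arcs (shadow G C) = {}"
  shows "bare_component G s (component_of (undirected_part G) u)"
proof -
  let ?U = "undirected_part G"
  have u: "u \<in> verts ?U"
    using cover_class_verts[OF G C(1)] C(2) by (force simp: undirected_part_def)
  have noarc: "(tail G a, True) \<notin> C" "(head G a, False) \<notin> C" if "a \<in> arcs G" for a
    using arcs that cover_class_arc[OF C(1) that] by (auto simp: shadow_def)
  have "(v, s) \<in> C" if "v \<in> reach ?U u" for v
    using linked_reach_undirected[OF G that] cover_class_closed[OF C] by blast
  then have "\<forall>a\<in>arcs G. (if s then tail G a else head G a) \<notin> reach ?U u"
    using noarc by (cases s) auto
  then show ?thesis
    using is_component_component_of[OF is_mixed_graph_undirected_part[OF G] u]
    by (simp add: bare_component_def component_of_def)
qed

lemma arcless_classes: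
  assumes G: "is_mixed_graph G"
  shows "{C \<in> cover_classes G. arcs (shadow G C) = {} \<and> (\<exists>u. (u, s) \<in> C)} =
    (\<lambda>H. verts H \<times> {s}) ` {H. bare_component G s H}" (is "?L = ?R")
proof (intro equalityI subsetI)
  fix C
  assume "C \<in> ?L"
  then obtain u where C: "C \<in> cover_classes G" "(u, s) \<in> C" "arcs (shadow G C) = {}"
    by blast
  let ?H = "component_of (undirected_part G) u"
  have H: "bare_component G s ?H"
    by (rule arcless_class_component[OF G C])
  have "u \<in> verts (undirected_part G)"
    using cover_class_verts[OF G C(1)] C(2) by (force simp: undirected_part_def)
  then have "u \<in> verts ?H"
    using reach_self by (simp add: component_of_def) fast
  then have "C = verts ?H \<times> {s}"
    using bare_component_class[OF G H] cover_class_eq[OF C(1,2)] by simp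
  with H show "C \<in> ?R"
    by blast
next
  fix C
  assume "C \<in> ?R"
  then obtain H where H: "bare_component G s H" and C: "C = verts H \<times> {s}"
    by blast
  obtain u where u: "u \<in> verts H"
    using H component_nonempty unfolding bare_component_def by blast
  then have "u \<in> verts G"
    using H by (auto simp: bare_component_def is_component_def submixed_def undirected_part_def)
  then have "C \<in> cover_classes G"
    using cover_classI[of u G s] bare_component_class[OF G H u] by (simp add: C)
  moreover have "arcs (shadow G C) = {}"
    using H by (auto simp: shadow_def C bare_component_def)
  ultimately show "C \<in> ?L"
    using u by (auto simp: C)
qed

lemma card_arcless_classes:
  assumes G: "is_mixed_graph G"
  shows "card {C \<in> cover_classes G. arcs (shadow G C) = {} \<and> (\<exists>u. (u, s) \<in> C)} =
    card {H. bare_component G s H}"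
  unfolding arcless_classes[OF G]
proof (rule card_image, rule inj_onI)
  fix H H'
  assume "H \<in> {H. bare_component G s H}" "H' \<in> {H. bare_component G s H}"
    and "verts H \<times> {s} = verts H' \<times> {s}"
  then show "H = H'"
    using component_verts_inj[OF is_mixed_graph_undirected_part[OF G]]
    by (auto simp: bare_component_def times_eq_iff)
qed

lemma finite_bare_components:
  assumes G: "is_mixed_graph G"
  shows "finite {H. bare_component G s H}"
proof (rule inj_on_finite)
  show "inj_on verts {H. bare_component G s H}"
    using component_verts_inj[OF is_mixed_graph_undirected_part[OF G]]
    by (auto simp: bare_component_def inj_on_def)
  show "verts ` {H. bare_component G s H} \<subseteq> Pow (verts G)"
    by (auto simp: bare_component_def is_component_def submixed_def undirected_part_def)
  show "finite (Pow (verts G))"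
    using G by (simp add: is_mixed_graph_def)
qed

text \<open>
  The components of \<open>G\<close> without arcs are those counted as type I and as type II. This accounts for the
  second summand in the number of mixed components.
\<close>

lemma arcless_component_iff:
  assumes G: "is_mixed_graph G"
  shows "is_component H G \<and> arcs H = {} \<longleftrightarrow> bare_component G True H \<and> bare_component G False H"
proof
  let ?U = "undirected_part G"
  have U: "is_mixed_graph ?U"
    by (rule is_mixed_graph_undirected_part[OF G])
  have eq: "component_of ?U u = component_of G u" if "reach ?U u = reach G u" "arcs (component_of G u) = {}" for u
    using that by (simp add: component_of_def undirected_part_def)
  have sub: "reach ?U u \<subseteq> reach G u" for u
    using walk_submixed[OF submixed_undirected_part[OF G]] by (auto simp: reach_def)
  {
    assume H: "is_component H G \<and> arcs H = {}"
    then obtain u where u: "u \<in> verts H"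
      using component_nonempty by blast
    then have Hu: "H = component_of G u"
      using H component_eq_component_of[OF _ G] by blast
    have uU: "u \<in> verts ?U"
      using H u by (auto simp: is_component_def submixed_def undirected_part_def)
    have tail: "tail G a \<notin> reach G u" if "a \<in> arcs G" for a
      using H that by (auto simp: Hu component_of_def)
    have head: "head G a \<notin> reach G u" if "a \<in> arcs G" for a
      using tail[OF that] reach_step[OF G, of "head G a" u "Backward a" "tail G a"] that by auto
    have "v \<in> reach ?U u" if "v \<in> reach G u" for v
      using G that
    proof (induction rule: reach_induct)
      case start
      show ?case
        by (rule reach_self[OF uU])
    next
      case (step v x w)
      then have "traverses ?U v x w"
        using tail head by (cases x) (auto simp: undirected_part_def)
      then show ?case
        using reach_step[OF U step.IH] by blast
    qed
    then have "reach ?U u = reach G u"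
      using sub by blast
    then have "H = component_of ?U u"
      using eq[of u] H by (simp add: Hu)
    then have "is_component H ?U"
      using is_component_component_of[OF U uU] by simp
    moreover have "verts H = reach G u"
      by (simp add: Hu component_of_def)
    ultimately show "bare_component G True H \<and> bare_component G False H"
      using tail head by (auto simp: bare_component_def)
  next
    assume H: "bare_component G True H \<and> bare_component G False H"
    then obtain u where u: "u \<in> verts H"
      using component_nonempty unfolding bare_component_def by blast
    then have Hu: "H = component_of ?U u"
      using H component_eq_component_of[OF _ U] by (auto simp: bare_component_def)
    have uG: "u \<in> verts G"
      using H u by (auto simp: bare_component_def is_component_def submixed_def undirected_part_def)
    have noarc: "tail G a \<notin> reach ?U u" "head G a \<notin> reach ?U u" if "a \<in> arcs G" for a
      using H that by (auto simp: Hu bare_component_def component_of_def)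
    have "v \<in> reach ?U u" if "v \<in> reach G u" for v
      using G that
    proof (induction rule: reach_induct)
      case start
      show ?case
        using uG by (intro reach_self) (simp add: undirected_part_def)
    next
      case (step v x w)
      then have "traverses ?U v x w"
        using noarc by (cases x) (auto simp: undirected_part_def)
      then show ?case
        using reach_step[OF U step.IH] by blast
    qed
    then have reach: "reach ?U u = reach G u"
      using sub by blast
    have "arcs (component_of G u) = {}"
      using noarc by (auto simp: component_of_def reach)
    then show "is_component H G \<and> arcs H = {}"
      using eq[OF reach] is_component_component_of[OF G uG] by (simp add: Hu)
  }
qed

text \<open>
  A component of the double cover without arcs is one-sided, so the components split into those with
  arcs and those without arcs on either side.
\<close>

lemma card_cover_classes:
  assumes G: "is_mixed_graph G"
  shows "card (cover_classes G) = num_mixed_components G"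
proof -
  let ?A = "\<lambda>s. {C \<in> cover_classes G. arcs (shadow G C) = {} \<and> (\<exists>u. (u, s) \<in> C)}"
  let ?B = "{C \<in> cover_classes G. arcs (shadow G C) \<noteq> {}}"
  let ?bare = "\<lambda>s. {H. bare_component G s H}"
  have fin: "finite (cover_classes G)"
    by (rule finite_cover_classes[OF G])
  have "C \<in> ?A True \<union> ?A False \<union> ?B" if C: "C \<in> cover_classes G" for C
  proof -
    obtain u s where "(u, s) \<in> C"
      using cover_class_nonempty[OF C] by blast
    then show ?thesis
      using C by (cases s) auto
  qed
  then have un: "cover_classes G = (?A True \<union> ?A False) \<union> ?B"
    by blast
  have "False" if T: "C \<in> ?A True" and F: "C \<in> ?A False" for C
  proof -
    obtain H where "bare_component G True H" "C = verts H \<times> {True}"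
      using T unfolding arcless_classes[OF G] by blast
    moreover obtain u where "(u, False) \<in> C"
      using F by blast
    ultimately show False
      by simp
  qed
  then have "?A True \<inter> ?A False = {}"
    by blast
  then have "card (?A True \<union> ?A False) = card (?A True) + card (?A False)"
    using fin by (intro card_Un_disjoint) simp_all
  then have "card (?A True \<union> ?A False) = card (?bare True) + card (?bare False)"
    by (simp only: card_arcless_classes[OF G])
  moreover have "(?A True \<union> ?A False) \<inter> ?B = {}"
    by auto
  ultimately have classes: "card (cover_classes G) = card (?bare True) + card (?bare False) + card ?B"
    using fin by (subst un, subst card_Un_disjoint) simp_all
  have III: "{H. type_III H G} = shadow G ` ?B"
    by (auto simp: type_III_iff_shadow[OF G])
  have "card {H. type_III H G} = card ?B"
    unfolding III by (rule card_image[OF inj_on_shadow])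
  moreover have finIII: "finite {H. type_III H G}"
    unfolding III using fin by simp
  have "{H. mixed_component H G} = (?bare True \<union> ?bare False) \<union> {H. type_III H G}"
    by (auto simp: mixed_component_def type_I_iff_bare[OF G] type_II_iff_bare[OF G])
  moreover have "(?bare True \<union> ?bare False) \<inter> {H. type_III H G} = {}"
    by (auto simp: bare_component_def is_component_def type_III_def special_def submixed_def
        undirected_part_def)
  ultimately have "card {H. mixed_component H G} = card (?bare True \<union> ?bare False) + card ?B"
    using finite_bare_components[OF G] finIII by (simp add: card_Un_disjoint)
  moreover have "{H. is_component H G \<and> arcs H = {}} = ?bare True \<inter> ?bare False"
    using arcless_component_iff[OF G] by blast
  ultimately show ?thesis
    using classes card_Un_Int[OF finite_bare_components[OF G] finite_bare_components[OF G], of True False]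
    by (simp add: num_mixed_components_def)
qed

section \<open>The integrated adjacency matrix as adjacency matrix of the double cover\<close>

definition cover_vertex :: "'v list \<Rightarrow> nat \<Rightarrow> 'v \<times> bool" where
  "cover_vertex vs i = (if i < length vs then (vs ! i, True) else (vs ! (i - length vs), False))"

lemma bij_betw_cover_vertex:
  assumes "distinct vs"
  shows "bij_betw (cover_vertex vs) {..<2 * length vs} (set vs \<times> UNIV)"
proof (rule bij_betwI')
  fix i j
  assume "i \<in> {..<2 * length vs}" "j \<in> {..<2 * length vs}"
  then show "cover_vertex vs i = cover_vertex vs j \<longleftrightarrow> i = j"
    using assms by (auto simp: cover_vertex_def nth_eq_iff_index_eq)
next
  fix i
  assume "i \<in> {..<2 * length vs}"
  then show "cover_vertex vs i \<in> set vs \<times> UNIV"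
    by (auto simp: cover_vertex_def)
next
  fix p
  assume "p \<in> set vs \<times> (UNIV :: bool set)"
  then obtain k s where k: "k < length vs" "p = (vs ! k, s)"
    by (auto simp: in_set_conv_nth)
  have "p = cover_vertex vs (if s then k else k + length vs)"
    using k by (auto simp: cover_vertex_def)
  then show "\<exists>i\<in>{..<2 * length vs}. p = cover_vertex vs i"
    using k(1) by (intro bexI[of _ "if s then k else k + length vs"]) auto
qed

lemma sum_cover_vertex:
  fixes g :: "'v \<times> bool \<Rightarrow> real"
  assumes "distinct vs"
  shows "(\<Sum>j<2 * length vs. g (cover_vertex vs j)) = (\<Sum>v\<in>set vs. g (v, True) + g (v, False))"
proof -
  have "(\<Sum>j<2 * length vs. g (cover_vertex vs j)) = (\<Sum>p\<in>set vs \<times> UNIV. g p)"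
    by (rule sum.reindex_bij_betw[OF bij_betw_cover_vertex[OF assms]])
  also have "\<dots> = (\<Sum>v\<in>set vs. \<Sum>s\<in>UNIV. g (v, s))"
    by (simp add: sum.cartesian_product)
  finally show ?thesis
    by (simp add: UNIV_bool add.commute)
qed

text \<open>The adjacency matrix of the double cover, indexed by the copies of the vertices.\<close>

definition adjacency :: "('v, 'e, 'a) mixed_graph \<Rightarrow> 'v \<times> bool \<Rightarrow> 'v \<times> bool \<Rightarrow> nat" where
  "adjacency G = (\<lambda>(u, s) (v, t).
     if s = t then (if u = v then 2 else 1) * card {e \<in> edges G. ends G e = {u, v}}
     else if s then card {a \<in> arcs G. tail G a = u \<and> head G a = v}
     else card {a \<in> arcs G. tail G a = v \<and> head G a = u})"

lemma adjacency_sym: "adjacency G p q = adjacency G q p"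
  by (cases p; cases q) (auto simp: adjacency_def insert_commute)

lemma adjacency_nonzero_iff:
  assumes "is_mixed_graph G"
  shows "adjacency G p q \<noteq> 0 \<longleftrightarrow> (p, q) \<in> cover_adj G"
proof -
  obtain u s v t where pq: "p = (u, s)" "q = (v, t)"
    by (cases p; cases q)
  have "finite (edges G)" "finite (arcs G)"
    using assms by (simp_all add: is_mixed_graph_def)
  then have nonzero: "adjacency G p q \<noteq> 0 \<longleftrightarrow>
     (if s = t then (\<exists>e\<in>edges G. ends G e = {u, v})
      else if s then (\<exists>a\<in>arcs G. tail G a = u \<and> head G a = v)
      else (\<exists>a\<in>arcs G. tail G a = v \<and> head G a = u))" (is "_ \<longleftrightarrow> ?R")
    by (simp add: pq adjacency_def card_gt_0_iff) blast
  have "(p, q) \<in> cover_adj G \<longleftrightarrow> ?R" (is "?L \<longleftrightarrow> _")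
  proof
    assume ?L
    then obtain x where "traverses G u x v" "lifts s [x] t"
      by (auto simp: cover_adj_def pq)
    then show ?R
      by (cases x) auto
  next
    assume R: ?R
    have "\<exists>x. traverses G u x v \<and> lifts s [x] t"
    proof (cases "s = t")
      case True
      then obtain e where "e \<in> edges G" "ends G e = {u, v}"
        using R by auto
      with True show ?thesis
        by (intro exI[of _ "Edge e"]) simp
    next
      case neq: False
      show ?thesis
      proof (cases s)
        case True
        then obtain a where "a \<in> arcs G" "tail G a = u" "head G a = v"
          using R neq by auto
        with True neq show ?thesis
          by (intro exI[of _ "Forward a"]) simp
      next
        case False
        then obtain a where "a \<in> arcs G" "tail G a = v" "head G a = u"
          using R neq by auto
        with False neq show ?thesis
          by (intro exI[of _ "Backward a"]) simp
      qed
    qed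
    then show ?L
      by (auto simp: cover_adj_def pq)
  qed
  with nonzero show ?thesis
    by (simp only:)
qed

lemma sum_edges_at:
  assumes G: "is_mixed_graph G" and u: "u \<in> verts G"
  shows "(\<Sum>v\<in>verts G. (if u = v then 2 else 1) * card {e \<in> edges G. ends G e = {u, v}}) =
    edge_degree G u"
proof -
  have fin: "finite (verts G)" "finite (edges G)"
    using G by (simp_all add: is_mixed_graph_def)
  have "(\<Sum>v\<in>verts G. card {e \<in> edges G. ends G e = {u, v}}) =
      card (\<Union>v\<in>verts G. {e \<in> edges G. ends G e = {u, v}})"
    using fin by (intro card_UN_disjoint[symmetric]) (auto simp: doubleton_eq_iff)
  also have "(\<Union>v\<in>verts G. {e \<in> edges G. ends G e = {u, v}}) = {e \<in> edges G. u \<in> ends G e}"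
  proof (intro equalityI subsetI)
    fix e
    assume e: "e \<in> {e \<in> edges G. u \<in> ends G e}"
    then obtain v w where "v \<in> verts G" "w \<in> verts G" "ends G e = {v, w}"
      using G unfolding is_mixed_graph_def by blast
    with e show "e \<in> (\<Union>v\<in>verts G. {e \<in> edges G. ends G e = {u, v}})"
      by (auto simp: insert_commute)
  qed auto
  finally have deg: "(\<Sum>v\<in>verts G. card {e \<in> edges G. ends G e = {u, v}}) =
      card {e \<in> edges G. u \<in> ends G e}" .
  have "(\<Sum>v\<in>verts G. (if u = v then 2 else 1) * card {e \<in> edges G. ends G e = {u, v}}) =
      (\<Sum>v\<in>verts G. card {e \<in> edges G. ends G e = {u, v}}
        + (if u = v then card {e \<in> edges G. ends G e = {u, v}} else 0))"
    by (intro sum.cong) auto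
  also have "\<dots> = edge_degree G u"
    using fin u by (simp add: sum.distrib deg edge_degree_def)
  finally show ?thesis .
qed

lemma sum_arcs_from:
  assumes "is_mixed_graph G"
  shows "(\<Sum>v\<in>verts G. card {a \<in> arcs G. tail G a = u \<and> head G a = v}) = out_degree G u"
proof -
  have "(\<Sum>v\<in>verts G. card {a \<in> arcs G. tail G a = u \<and> head G a = v}) =
      card (\<Union>v\<in>verts G. {a \<in> arcs G. tail G a = u \<and> head G a = v})"
    using assms by (intro card_UN_disjoint[symmetric]) (auto simp: is_mixed_graph_def)
  also have "(\<Union>v\<in>verts G. {a \<in> arcs G. tail G a = u \<and> head G a = v}) = {a \<in> arcs G. tail G a = u}"
    using assms by (auto simp: is_mixed_graph_def)
  finally show ?thesis
    by (simp add: out_degree_def)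
qed

lemma sum_arcs_to:
  assumes "is_mixed_graph G"
  shows "(\<Sum>v\<in>verts G. card {a \<in> arcs G. tail G a = v \<and> head G a = u}) = in_degree G u"
proof -
  have "(\<Sum>v\<in>verts G. card {a \<in> arcs G. tail G a = v \<and> head G a = u}) =
      card (\<Union>v\<in>verts G. {a \<in> arcs G. tail G a = v \<and> head G a = u})"
    using assms by (intro card_UN_disjoint[symmetric]) (auto simp: is_mixed_graph_def)
  also have "(\<Union>v\<in>verts G. {a \<in> arcs G. tail G a = v \<and> head G a = u}) = {a \<in> arcs G. head G a = u}"
    using assms by (auto simp: is_mixed_graph_def)
  finally show ?thesis
    by (simp add: in_degree_def)
qed

lemma adjacency_row_sum:
  assumes G: "is_mixed_graph G" and reg: "regular r G" and u: "u \<in> verts G"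
  shows "(\<Sum>v\<in>verts G. adjacency G (u, s) (v, True) + adjacency G (u, s) (v, False)) = r"
proof -
  have "edge_degree G u + out_degree G u = r" "in_degree G u = out_degree G u"
    using reg u by (auto simp: regular_def)
  then show ?thesis
    using sum_edges_at[OF G u] sum_arcs_from[OF G, of u] sum_arcs_to[OF G, of u]
    by (cases s) (simp_all add: adjacency_def sum.distrib)
qed

lemma integrated_adjacency_carrier:
  "integrated_adjacency G vs \<in> carrier_mat (2 * length vs) (2 * length vs)"
proof -
  have "integrated_adjacency G vs \<in> carrier_mat (length vs + length vs) (length vs + length vs)"
    unfolding integrated_adjacency_def
    by (rule four_block_carrier_mat) (simp_all add: edge_block_def arc_block_def)
  then show ?thesis
    by (simp add: mult_2)
qed

lemma integrated_adjacency_entry: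
  assumes "distinct vs" "i < 2 * length vs" "j < 2 * length vs"
  shows "integrated_adjacency G vs $$ (i, j) =
    real (adjacency G (cover_vertex vs i) (cover_vertex vs j))"
  using assms
  by (auto simp: integrated_adjacency_def edge_block_def arc_block_def cover_vertex_def
      adjacency_def nth_eq_iff_index_eq)

lemma card_cover_vertex_classes:
  assumes "distinct vs" "set vs = verts G"
  shows "card ((\<lambda>i. linked G `` {cover_vertex vs i}) ` {..<2 * length vs}) = card (cover_classes G)"
proof -
  have "(\<lambda>i. linked G `` {cover_vertex vs i}) ` {..<2 * length vs} =
      (\<lambda>p. linked G `` {p}) ` cover_vertex vs ` {..<2 * length vs}"
    by (simp only: image_image)
  also have "\<dots> = (\<lambda>p. linked G `` {p}) ` (verts G \<times> UNIV)"
    by (simp only: bij_betw_imp_surj_on[OF bij_betw_cover_vertex[OF assms(1)]] assms(2))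
  also have "\<dots> = cover_classes G"
    by (auto simp: cover_classes_def quotient_def)
  finally show ?thesis
    by simp
qed

lemma linked_cover_vertex_iff:
  assumes G: "is_mixed_graph G" and vs: "distinct vs" "set vs = verts G"
    and i: "i < 2 * length vs" and j: "j < 2 * length vs"
  shows "linked G `` {cover_vertex vs i} = linked G `` {cover_vertex vs j} \<longleftrightarrow>
    (i, j) \<in> {(i, j). i < 2 * length vs \<and> j < 2 * length vs \<and>
      integrated_adjacency G vs $$ (i, j) \<noteq> 0}\<^sup>*" (is "_ \<longleftrightarrow> _ \<in> ?E\<^sup>*")
proof -
  let ?c = "cover_vertex vs"
  have bij: "bij_betw ?c {..<2 * length vs} (verts G \<times> UNIV)"
    using bij_betw_cover_vertex[OF vs(1)] vs(2) by simp
  have entry: "integrated_adjacency G vs $$ (i, j) \<noteq> 0 \<longleftrightarrow> (?c i, ?c j) \<in> cover_adj G"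
    if "i < 2 * length vs" "j < 2 * length vs" for i j
    using adjacency_nonzero_iff[OF G, of "?c i" "?c j"]
    by (simp only: integrated_adjacency_entry[OF vs(1) that] of_nat_eq_0_iff)
  have E: "?E = {(i, j). i < 2 * length vs \<and> j < 2 * length vs \<and> (?c i, ?c j) \<in> cover_adj G}"
    using entry by blast
  have to_E: "\<exists>k<2 * length vs. q = ?c k \<and> (i, k) \<in> ?E\<^sup>*" if "(?c i, q) \<in> (cover_adj G)\<^sup>*" for q
    using that
  proof (induction rule: rtrancl_induct)
    case base
    then show ?case
      using i by blast
  next
    case (step q q')
    then obtain k where k: "k < 2 * length vs" "q = ?c k" "(i, k) \<in> ?E\<^sup>*"
      by blast
    have "fst q' \<in> verts G"
      using step(2) traverses_verts[OF G] by (auto simp: cover_adj_def)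
    then have "q' \<in> ?c ` {..<2 * length vs}"
      using bij_betw_imp_surj_on[OF bij] by (cases q') auto
    then obtain l where l: "l < 2 * length vs" "q' = ?c l"
      by blast
    have "(k, l) \<in> ?E"
      unfolding E using k(1,2) l step(2) by blast
    then have "(i, l) \<in> ?E\<^sup>*"
      using k(3) by (rule rtrancl_into_rtrancl[rotated])
    with l show ?case
      by blast
  qed
  have from_E: "(?c i, ?c k) \<in> (cover_adj G)\<^sup>*" if "(i, k) \<in> ?E\<^sup>*" for k
    using that
  proof (induction rule: rtrancl_induct)
    case (step k l)
    then have "(?c k, ?c l) \<in> cover_adj G"
      unfolding E by blast
    with step.IH show ?case
      by (rule rtrancl_into_rtrancl)
  qed simp
  have "(?c i, ?c j) \<in> linked G \<longleftrightarrow> (i, j) \<in> ?E\<^sup>*"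
  proof
    assume "(?c i, ?c j) \<in> linked G"
    then obtain k where k: "k < 2 * length vs" "?c j = ?c k" "(i, k) \<in> ?E\<^sup>*"
      using to_E unfolding linked_def by blast
    have "j = k"
      using k(1) j by (intro inj_onD[OF bij_betw_imp_inj_on[OF bij] k(2)]) simp_all
    with k(3) show "(i, j) \<in> ?E\<^sup>*"
      by simp
  next
    assume "(i, j) \<in> ?E\<^sup>*"
    then show "(?c i, ?c j) \<in> linked G"
      unfolding linked_def by (rule from_E)
  qed
  then show ?thesis
    by (simp only: eq_equiv_class_iff[OF equiv_linked UNIV_I UNIV_I])
qed

theorem theorem6p2:
  fixes G :: "('v, 'e, 'a) mixed_graph" and vs :: "'v list" and r :: nat
  assumes "is_mixed_graph G" and "simple G" and "regular r G"
    and "distinct vs" and "set vs = verts G"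
  shows "lambda (integrated_adjacency G vs) 1 = real r \<and>
         eigenvalue_multiplicity (integrated_adjacency G vs) (real r) = num_mixed_components G"
proof -
  note G = assms(1) and vs = assms(4,5)
  let ?A = "integrated_adjacency G vs" and ?m = "2 * length vs"
  note carrier = integrated_adjacency_carrier[of G vs]
  note entry = integrated_adjacency_entry[OF vs(1)]
  have sym: "?A $$ (i, j) = ?A $$ (j, i)" if "i < ?m" "j < ?m" for i j
    using that by (simp only: entry adjacency_sym)
  have nonneg: "?A $$ (i, j) \<ge> 0" if "i < ?m" "j < ?m" for i j
    using that by (simp only: entry of_nat_0_le_iff)
  have rows: "(\<Sum>j<?m. ?A $$ (i, j)) = real r" if i: "i < ?m" for i
  proof -
    obtain u s where us: "cover_vertex vs i = (u, s)"
      by fastforce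
    then have u: "u \<in> verts G"
      using bij_betwE[OF bij_betw_cover_vertex[OF vs(1)]] i vs(2) by force
    have "(\<Sum>j<?m. ?A $$ (i, j)) = (\<Sum>j<?m. real (adjacency G (u, s) (cover_vertex vs j)))"
      using i by (intro sum.cong) (simp_all only: entry us lessThan_iff)
    also have "\<dots> = real (\<Sum>v\<in>verts G. adjacency G (u, s) (v, True) + adjacency G (u, s) (v, False))"
      using sum_cover_vertex[OF vs(1), of "\<lambda>p. real (adjacency G (u, s) p)"]
      by (simp only: vs(2) of_nat_sum of_nat_add)
    finally show ?thesis
      by (simp only: adjacency_row_sum[OF G assms(3) u])
  qed
  have "order (real r) (char_poly ?A) =
      card ((\<lambda>i. linked G `` {cover_vertex vs i}) ` {..<?m})"
    by (rule order_char_poly_row_sum[OF carrier sym rows nonneg])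
      (simp_all only: linked_cover_vertex_iff[OF G vs])
  then have order: "order (real r) (char_poly ?A) = card (cover_classes G)"
    by (simp only: card_cover_vertex_classes[OF vs])
  have "verts G \<noteq> {}"
    using G by (simp add: is_mixed_graph_def)
  then have "cover_classes G \<noteq> {}"
    by (simp add: cover_classes_def quotient_def)
  then have "order (real r) (char_poly ?A) \<noteq> 0"
    using finite_cover_classes[OF G] by (simp add: order)
  then have "eigenvalue ?A (real r)"
    unfolding eigenvalue_root_char_poly[OF carrier] by (metis order_0I)
  then have "lambda ?A 1 = real r"
    by (rule lambda_1_eqI[OF carrier]) (rule eigenvalue_le_row_sum[OF carrier sym rows nonneg])
  then show ?thesis
    using card_cover_classes[OF G] by (simp add: eigenvalue_multiplicity_def order)
qed

end
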